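(* Let $q$ and $b$ be integers such that $q\ge 2$, $q$ divides $b$, and $b/q\ge 2$. Let $\tau:\Sigma_q^\ast\to\{-1,0,\ldots,b-2\}$ be a maximal tree mapping such that $$\mathcal D_\tau:=\sup\{\mathcal D_{\tau,\delta}:\ \delta\in\Sigma_q^\ast\}<\infty .$$ Then $\Lambda(\tau)$ is a spectrum of the Cantor measure $\mu_{q,b}$.
   Context: Cantor measure: $\mu_{q,b}$ is the unique Borel probability measure on $\mathbb R$ with $\mu_{q,b}=\frac1q\sum_{i=0}^{q-1}\mu_{q,b}(f_i^{-1}(\cdot))$, where $f_i(x)=x/b+i/q$, $0\le i\le q-1$. A countable set $\Lambda\subset\mathbb R$ is a spectrum of a probability measure $\mu$ if $\{e^{-2\pi i\lambda x}:\lambda\in\Lambda\}$ is an orthogonal basis of $L^2(\mu)$. Words: $\Sigma_q=\{0,1,\ldots,q-1\}$; $\Sigma_q^n$ is the set of words of length $n$ over $\Sigma_q$; $\Sigma_q^\ast=\bigcup_{1\le n<\infty}\Sigma_q^n$; $\Sigma_q^\infty$ is the set of infinite words. Juxtaposition denotes concatenation; $0^k$ is the word of $k$ zeros and $0^\infty=000\cdots$. For $k\ge1$, $\delta|_k$ is the prefix of length $k$ of $\delta$ if $\delta\in\Sigma_q^\infty$, and the prefix of length $k$ of $\delta0^\infty$ if $\delta\in\Sigma_q^\ast$. Tree mapping: a map $\tau:\Sigma_q^\ast\to\{-1,0,\ldots,b-2\}$ with (i) $\tau(0^n)=0$ for all $n\ge1$; (ii) $\tau(\delta)\in\delta_n+q\mathbb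 Z$ for every $\delta=\delta_1\cdots\delta_n\in\Sigma_q^n$, $n\ge1$. It is maximal if (iii) for any $\delta\in\Sigma_q^\ast$ there exists $\delta'\in\Sigma_q^\ast$ such that $\tau((\delta\delta')|_n)=0$ for all sufficiently large $n$. $\Lambda(\tau):=\{\sum_{n=1}^\infty\tau(\delta|_n)b^{n-1}:\ \delta\in\Sigma_q^\ast\text{ such that }\tau(\delta|_m)=0\text{ for all sufficiently large }m\}$. Level difference: for $\delta,\delta'\in\Sigma_q^\ast$ put $A_\delta(\delta')=\{m\ge1:\tau(\delta(\delta'|_m))\ne0\}$ and $B_\delta(\delta')=\{m\ge1:\tau(\delta(\delta'|_m))\notin q\mathbb Z\}$; enumerate $A_\delta(\delta')=\{n_j:j\ge1\}$ in strictly increasing order and put $n_0=0$. Then $$\mathcal D_{\tau,\delta}(\delta')=\#A_\delta(\delta')+\sum_{n_j\in B_\delta(\delta')}(n_j-n_{j-1}-1),$$ (with value $\infty$ if $A_\delta(\delta')$ is infinite), and $\mathcal D_{\tau,\delta}:=\inf\{\mathcal D_{\tau,\delta}(\delta'):\delta'\in\Sigma_q^\ast\}$. *)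

theory Defs
  imports "HOL-Probability.Probability"
begin

section \<open>Cantor measures\<close>

definition cantor_map :: "nat \<Rightarrow> nat \<Rightarrow> nat \<Rightarrow> real \<Rightarrow> real" where
  "cantor_map q b i x = x / real b + real i / real q"

definition is_cantor_measure :: "nat \<Rightarrow> nat \<Rightarrow> real measure \<Rightarrow> bool" where
  "is_cantor_measure q b M \<longleftrightarrow>
     prob_space M \<and> sets M = sets borel \<and>
     (\<forall>A\<in>sets borel. measure M A = (1 / real q) * (\<Sum>i<q. measure M (cantor_map q b i -` A)))"

definition cantor_measure :: "nat \<Rightarrow> nat \<Rightarrow> real measure" where
  "cantor_measure q b = (THE M. is_cantor_measure q b M)"

subsection \<open>The defining equation has exactly one solution\<close>

definition cantor_step :: "nat \<Rightarrow> nat \<Rightarrow> real measure \<Rightarrow> real measure" where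
  "cantor_step q b M =
     distr (measure_pmf (pmf_of_set {..<q}) \<Otimes>\<^sub>M M) borel (\<lambda>(i, x). cantor_map q b i x)"

lemma borel_measurable_cantor_map [measurable]: "cantor_map q b i \<in> borel_measurable borel"
  unfolding cantor_map_def by measurable

lemma measurable_cantor_map_pair:
  assumes M: "sets M = sets borel"
  shows "(\<lambda>(i, x). cantor_map q b i x) \<in>
     borel_measurable (measure_pmf (pmf_of_set {..<q}) \<Otimes>\<^sub>M M)"
proof -
  note M [measurable_cong]
  show ?thesis
    unfolding cantor_map_def by measurable
qed

lemma emeasure_cantor_step:
  assumes q: "1 \<le> q" and M: "prob_space M" "sets M = sets borel" and A: "A \<in> sets borel"
  shows "emeasure (cantor_step q b M) A =
     ennreal ((1 / real q) * (\<Sum>i<q. measure M (cantor_map q b i -` A)))"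
proof -
  interpret M: prob_space M by fact
  note M(2) [measurable_cong]
  note measurable_cantor_map_pair[OF M(2), measurable]
  let ?U = "measure_pmf (pmf_of_set {..<q})"
  let ?F = "\<lambda>(i, x). cantor_map q b i x"
  have sp: "space M = UNIV" using sets_eq_imp_space_eq[OF M(2)] by simp
  have ne: "{..<q} \<noteq> {}" "finite {..<q}" using q by (auto simp: lessThan_empty_iff)
  have "emeasure (cantor_step q b M) A = emeasure (?U \<Otimes>\<^sub>M M) (?F -` A \<inter> space (?U \<Otimes>\<^sub>M M))"
    unfolding cantor_step_def by (subst emeasure_distr) (use A in auto)
  also have "\<dots> = (\<integral>\<^sup>+ i. emeasure M (Pair i -` (?F -` A \<inter> space (?U \<Otimes>\<^sub>M M))) \<partial>?U)"
    by (rule M.emeasure_pair_measure_alt) (use A in measurable)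
  also have "\<dots> = (\<integral>\<^sup>+ i. ennreal (measure M (cantor_map q b i -` A)) \<partial>?U)"
    by (intro nn_integral_cong)
       (simp add: M.emeasure_eq_measure space_pair_measure sp vimage_def)
  also have "\<dots> = (\<Sum>i<q. ennreal (measure M (cantor_map q b i -` A))) / of_nat q"
    by (subst nn_integral_pmf_of_set[OF ne(1) ne(2)]) (simp add: ennreal_of_nat_eq_real_of_nat)
  also have "\<dots> = ennreal ((1 / real q) * (\<Sum>i<q. measure M (cantor_map q b i -` A)))"
    using q by (simp add: sum_nonneg divide_ennreal ennreal_of_nat_eq_real_of_nat)
  finally show ?thesis .
qed

lemma is_cantor_measure_iff:
  assumes q: "1 \<le> q" and M: "prob_space M" "sets M = sets borel"
  shows "is_cantor_measure q b M \<longleftrightarrow> cantor_step q b M = M"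
proof -
  interpret M: prob_space M by fact
  have s: "sets (cantor_step q b M) = sets borel" by (simp add: cantor_step_def)
  have "cantor_step q b M = M \<longleftrightarrow>
      (\<forall>A\<in>sets borel. emeasure (cantor_step q b M) A = emeasure M A)"
    using s M(2) by (auto intro!: measure_eqI)
  also have "\<dots> \<longleftrightarrow> (\<forall>A\<in>sets borel.
      (1 / real q) * (\<Sum>i<q. measure M (cantor_map q b i -` A)) = measure M A)"
    by (intro ball_cong refl)
       (simp add: emeasure_cantor_step[OF q M] M.emeasure_eq_measure sum_nonneg)
  finally show ?thesis
    using M by (auto simp: is_cantor_measure_def)
qed

lemma char_is_cantor_measure:
  assumes q: "1 \<le> q" and M: "is_cantor_measure q b M"
  shows "char M t = (\<Sum>i<q. iexp (t * real i / real q)) / q * char M (t / real b)"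
proof -
  have P: "prob_space M" and s: "sets M = sets borel" using M by (auto simp: is_cantor_measure_def)
  interpret M: prob_space M by fact
  note s [measurable_cong]
  note measurable_cantor_map_pair[OF s, measurable]
  let ?U = "measure_pmf (pmf_of_set {..<q})"
  interpret pair_prob_space ?U M ..
  have ne: "{..<q} \<noteq> {}" "finite {..<q}" using q by (auto simp: lessThan_empty_iff)
  have eq: "M = cantor_step q b M" using is_cantor_measure_iff[OF q P s] M by simp
  have "char M t = (CLINT x|cantor_step q b M. iexp (t * x))"
    unfolding char_def by (subst eq) simp
  also have "\<dots> = (CLINT z|?U \<Otimes>\<^sub>M M. iexp (t * (case z of (i, x) \<Rightarrow> cantor_map q b i x)))"
    unfolding cantor_step_def by (subst integral_distr) auto
  also have "\<dots> = (CLINT i|?U. CLINT x|M. iexp (t * cantor_map q b i x))"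
  proof (subst integral_fst'[symmetric])
    show "integrable (?U \<Otimes>\<^sub>M M) (\<lambda>z. iexp (t * (case z of (i, x) \<Rightarrow> cantor_map q b i x)))"
      by (rule P.integrable_const_bound[where B = 1]) auto
  qed simp
  also have "\<dots> = (CLINT i|?U. iexp (t * real i / real q) * char M (t / real b))"
  proof (rule Bochner_Integration.integral_cong[OF refl])
    fix i
    have "(CLINT x|M. iexp (t * cantor_map q b i x)) =
        (CLINT x|M. iexp (t * real i / real q) * iexp (t / real b * x))"
      by (intro Bochner_Integration.integral_cong refl)
         (simp add: cantor_map_def exp_add[symmetric] algebra_simps)
    then show "(CLINT x|M. iexp (t * cantor_map q b i x)) =
        iexp (t * real i / real q) * char M (t / real b)"
      by (simp add: char_def)
  qed
  also have "\<dots> = (\<Sum>i<q. iexp (t * real i / real q)) / q * char M (t / real b)"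
    using ne
    by (subst integral_measure_pmf[of "{..<q}"])
       (auto simp: sum_distrib_right sum_divide_distrib set_pmf_of_set scaleR_conv_of_real)
  finally show ?thesis .
qed

lemma is_cantor_measure_unique:
  assumes q: "1 \<le> q" and b: "2 \<le> b"
    and M: "is_cantor_measure q b M" and N: "is_cantor_measure q b N"
  shows "M = N"
proof -
  interpret M: real_distribution M
    using M by (auto simp: is_cantor_measure_def real_distribution_def real_distribution_axioms_def)
  interpret N: real_distribution N
    using N by (auto simp: is_cantor_measure_def real_distribution_def real_distribution_axioms_def)
  define D where "D t = cmod (char M t - char N t)" for t
  have step: "D t \<le> D (t / real b)" for t
  proof -
    define m where "m = (\<Sum>i<q. iexp (t * real i / real q)) / of_nat q"
    have "cmod (\<Sum>i<q. iexp (t * real i / real q)) \<le> (\<Sum>i<q. 1)"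
      by (rule sum_norm_le) simp
    then have m: "cmod m \<le> 1" using q by (simp add: m_def norm_divide)
    have "char M t - char N t = m * (char M (t / real b) - char N (t / real b))"
      using char_is_cantor_measure[OF q M, of t] char_is_cantor_measure[OF q N, of t]
      by (simp add: m_def right_diff_distrib)
    then have "D t = cmod m * D (t / real b)" by (simp add: D_def norm_mult)
    also have "\<dots> \<le> 1 * D (t / real b)"
      by (rule mult_right_mono[OF m]) (simp add: D_def)
    finally show ?thesis by simp
  qed
  have iter: "D t \<le> D (t / real b ^ n)" for t n
  proof (induction n)
    case (Suc n)
    also have "D (t / real b ^ n) \<le> D (t / real b ^ Suc n)"
      using step[of "t / real b ^ n"] by (simp add: mult.commute)
    finally show ?case .
  qed simp
  have "char M t = char N t" for t
  proof -
    have "isCont D 0"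
      unfolding D_def by (intro continuous_intros M.isCont_char N.isCont_char)
    moreover have "(\<lambda>n. t / real b ^ n) \<longlonglongrightarrow> 0"
      using b tendsto_mult_right_zero[OF LIMSEQ_inverse_realpow_zero[of "real b"], of t]
      by (simp add: divide_inverse)
    ultimately have "(\<lambda>n. D (t / real b ^ n)) \<longlonglongrightarrow> D 0"
      by (rule isCont_tendsto_compose)
    then have "D t \<le> D 0"
      by (rule LIMSEQ_le_const) (use iter in auto)
    then show ?thesis by (simp add: D_def M.char_zero N.char_zero)
  qed
  then show ?thesis
    by (intro Levy_uniqueness M.real_distribution_axioms N.real_distribution_axioms) auto
qed

lemma is_cantor_measure_exists:
  assumes q: "1 \<le> q" and b: "2 \<le> b"
  shows "\<exists>M. is_cantor_measure q b M"
proof -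
  define U where "U = measure_pmf (pmf_of_set {..<q})"
  define X :: "(nat \<Rightarrow> nat) \<Rightarrow> real" where
    "X w = (\<Sum>n. min (real (w n)) (real q) / real q * (1 / real b) ^ n)" for w
  interpret U: prob_space U unfolding U_def by (rule prob_space_measure_pmf)
  interpret sequence_space U ..
  have summ: "summable (\<lambda>n. min (real (w n)) (real q) / real q * (1 / real b) ^ n)" for w :: "nat \<Rightarrow> nat"
  proof (rule summable_comparison_test')
    show "summable (\<lambda>n. (1 / real b) ^ n)" using b by (intro summable_geometric) auto
    show "norm (min (real (w n)) (real q) / real q * (1 / real b) ^ n) \<le> (1 / real b) ^ n" for n
    proof -
      have "min (real (w n)) (real q) / real q \<le> 1" using q by simp
      then have "min (real (w n)) (real q) / real q * (1 / real b) ^ n \<le> 1 * (1 / real b) ^ n"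
        by (rule mult_right_mono) simp
      then show ?thesis by (simp add: abs_mult)
    qed
  qed
  have setsU [measurable_cong]: "sets U = sets (count_space UNIV)" by (simp add: U_def)
  have [measurable]: "X \<in> borel_measurable S"
    unfolding X_def by measurable
  have X_cons: "X (case_nat i w) = cantor_map q b i (X w)" if "i < q" for i w
  proof -
    have "X (case_nat i w) = (\<Sum>n. min (real (w n)) (real q) / real q * (1 / real b) ^ Suc n) + real i / real q"
      unfolding X_def using suminf_split_head[OF summ[of "case_nat i w"]] that by simp
    also have "(\<Sum>n. min (real (w n)) (real q) / real q * (1 / real b) ^ Suc n) = X w / real b"
      unfolding X_def using suminf_mult[OF summ[of w], of "1 / real b"]
      by (simp add: mult_ac)
    finally show ?thesis by (simp add: cantor_map_def)
  qed
  define M where "M = distr S borel X"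
  have P: "prob_space M" unfolding M_def by (rule prob_space_distr) measurable
  interpret M: prob_space M by fact
  have s: "sets M = sets borel" by (simp add: M_def)
  note s [measurable_cong]
  note F = measurable_cantor_map_pair[OF s, of q b, folded U_def]
  have F': "(\<lambda>(i, x). cantor_map q b i x) \<in> borel_measurable (U \<Otimes>\<^sub>M borel)"
    using F by (simp add: measurable_def sets_pair_measure_cong[OF refl s] space_pair_measure M_def)
  have "M = distr (distr (U \<Otimes>\<^sub>M S) S (\<lambda>(s, \<omega>). case_nat s \<omega>)) borel X"
    unfolding M_def by (subst PiM_iter) simp
  also have "\<dots> = distr (U \<Otimes>\<^sub>M S) borel (\<lambda>(i, w). X (case_nat i w))"
    by (subst distr_distr) (auto simp: comp_def split_def)
  also have "\<dots> = distr (U \<Otimes>\<^sub>M S) borel (\<lambda>(i, w). cantor_map q b i (X w))"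
  proof (rule distr_cong_AE)
    interpret US: pair_prob_space U S ..
    have "AE i in U. i < q"
      unfolding U_def using q by (subst AE_measure_pmf_iff) (auto simp: set_pmf_of_set lessThan_empty_iff)
    then have "AE i in U. AE w in S. X (case_nat i w) = cantor_map q b i (X w)"
      by (auto simp: X_cons)
    then show "AE z in U \<Otimes>\<^sub>M S. (case z of (i, w) \<Rightarrow> X (case_nat i w)) = (case z of (i, w) \<Rightarrow> cantor_map q b i (X w))"
      by (intro US.AE_pair_measure) (auto simp: cantor_map_def)
  qed (auto simp: cantor_map_def)
  also have "\<dots> = distr (distr (U \<Otimes>\<^sub>M S) (U \<Otimes>\<^sub>M borel) (\<lambda>(i, w). (i, X w))) borel (\<lambda>(i, x). cantor_map q b i x)"
    by (subst distr_distr) (auto simp: comp_def split_def F' [unfolded split_def])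
  also have "distr (U \<Otimes>\<^sub>M S) (U \<Otimes>\<^sub>M borel) (\<lambda>(i, w). (i, X w)) = U \<Otimes>\<^sub>M M"
  proof -
    have "distr U U (\<lambda>i. i) \<Otimes>\<^sub>M distr S borel X = distr (U \<Otimes>\<^sub>M S) (U \<Otimes>\<^sub>M borel) (\<lambda>(i, w). (i, X w))"
      by (rule pair_measure_distr) (use P in \<open>auto simp: M_def prob_space_imp_sigma_finite\<close>)
    then show ?thesis by (simp add: M_def)
  qed
  finally have "cantor_step q b M = M"
    by (simp add: cantor_step_def U_def)
  then show ?thesis using is_cantor_measure_iff[OF q P s] by blast
qed

lemma is_cantor_measure_cantor_measure:
  assumes "1 \<le> q" and "2 \<le> b"
  shows "is_cantor_measure q b (cantor_measure q b)"
  unfolding cantor_measure_def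
  by (rule theI') (use is_cantor_measure_exists is_cantor_measure_unique assms in blast)

section \<open>Spectra\<close>

definition l2_fun :: "real measure \<Rightarrow> (real \<Rightarrow> complex) \<Rightarrow> bool" where
  "l2_fun M f \<longleftrightarrow> f \<in> borel_measurable M \<and> integrable M (\<lambda>x. (cmod (f x))\<^sup>2)"

definition expo :: "real \<Rightarrow> real \<Rightarrow> complex" where
  "expo l x = exp (- 2 * of_real pi * \<i> * of_real l * of_real x)"

text \<open>An orthogonal basis of the Hilbert space \<open>L\<^sup>2(M)\<close> is a pairwise orthogonal family of non-zero
  vectors whose linear span is dense. Exponentials have modulus \<open>1\<close>, so they are non-zero in
  \<open>L\<^sup>2(M)\<close> for every probability measure \<open>M\<close>. The family is indexed by \<open>L\<close>: distinct
  frequencies must give orthogonal exponentials. For square-integrable \<open>f\<close> the integrand in the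
  density condition is integrable, so its integral is the squared \<open>L\<^sup>2\<close> distance.\<close>

definition is_spectrum :: "real set \<Rightarrow> real measure \<Rightarrow> bool" where
  "is_spectrum L M \<longleftrightarrow>
     countable L \<and>
     (\<forall>l\<in>L. \<forall>l'\<in>L. l \<noteq> l' \<longrightarrow> (LINT x|M. expo l x * cnj (expo l' x)) = 0) \<and>
     (\<forall>f. l2_fun M f \<longrightarrow> (\<forall>\<epsilon>>0. \<exists>F c. finite F \<and> F \<subseteq> L \<and>
        (LINT x|M. (cmod (f x - (\<Sum>l\<in>F. c l * expo l x)))\<^sup>2) < \<epsilon>))"

section \<open>Words and tree mappings\<close>

definition words :: "nat \<Rightarrow> nat list set" where
  "words q = {w. w \<noteq> [] \<and> set w \<subseteq> {..<q}}"

text \<open>The prefix of length \<open>k\<close> of the infinite word \<open>w000\<dots>\<close>.\<close>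

definition pref :: "nat list \<Rightarrow> nat \<Rightarrow> nat list" where
  "pref w k = take k (w @ replicate k 0)"

text \<open>Values of \<open>\<tau>\<close> outside \<open>words q\<close> are irrelevant.\<close>

definition tree_mapping :: "nat \<Rightarrow> nat \<Rightarrow> (nat list \<Rightarrow> int) \<Rightarrow> bool" where
  "tree_mapping q b \<tau> \<longleftrightarrow>
     (\<forall>w\<in>words q. \<tau> w \<in> {-1..int b - 2}) \<and>
     (\<forall>n\<ge>1. \<tau> (replicate n 0) = 0) \<and>
     (\<forall>w\<in>words q. \<exists>k. \<tau> w = int (last w) + int q * k)"

definition maximal_tree_mapping :: "nat \<Rightarrow> nat \<Rightarrow> (nat list \<Rightarrow> int) \<Rightarrow> bool" where
  "maximal_tree_mapping q b \<tau> \<longleftrightarrow>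
     tree_mapping q b \<tau> \<and>
     (\<forall>w\<in>words q. \<exists>w'\<in>words q. \<forall>\<^sub>F n in sequentially. \<tau> (pref (w @ w') n) = 0)"

text \<open>All but finitely many terms of the series below vanish.\<close>

definition tree_spectrum :: "nat \<Rightarrow> nat \<Rightarrow> (nat list \<Rightarrow> int) \<Rightarrow> real set" where
  "tree_spectrum q b \<tau> =
     {(\<Sum>n. real_of_int (\<tau> (pref w (Suc n))) * real b ^ n) | w.
        w \<in> words q \<and> (\<forall>\<^sub>F m in sequentially. \<tau> (pref w m) = 0)}"

section \<open>Level differences\<close>

definition level_A :: "(nat list \<Rightarrow> int) \<Rightarrow> nat list \<Rightarrow> nat list \<Rightarrow> nat set" where
  "level_A \<tau> w w' = {m. m \<ge> 1 \<and> \<tau> (w @ pref w' m) \<noteq> 0}"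

definition level_B :: "nat \<Rightarrow> (nat list \<Rightarrow> int) \<Rightarrow> nat list \<Rightarrow> nat list \<Rightarrow> nat set" where
  "level_B q \<tau> w w' = {m. m \<ge> 1 \<and> \<not> int q dvd \<tau> (w @ pref w' m)}"

text \<open>For finite \<open>A\<close>, the elements of \<open>A\<close> in increasing order are \<open>ns ! 1, ns ! 2, \<dots>\<close>, and
  \<open>ns ! 0 = 0\<close>. They are positive, so no subtraction below is truncated.\<close>

definition level_diff :: "nat \<Rightarrow> (nat list \<Rightarrow> int) \<Rightarrow> nat list \<Rightarrow> nat list \<Rightarrow> enat" where
  "level_diff q \<tau> w w' =
     (let A = level_A \<tau> w w'; B = level_B q \<tau> w w'; ns = 0 # sorted_list_of_set A in
      if finite A
      then enat (card A + (\<Sum>j\<in>{j\<in>{1..card A}. ns ! j \<in> B}. ns ! j - ns ! (j - 1) - 1))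
      else \<infinity>)"

definition level_diff_inf :: "nat \<Rightarrow> (nat list \<Rightarrow> int) \<Rightarrow> nat list \<Rightarrow> enat" where
  "level_diff_inf q \<tau> w = (INF w'\<in>words q. level_diff q \<tau> w w')"

definition level_diff_sup :: "nat \<Rightarrow> (nat list \<Rightarrow> int) \<Rightarrow> enat" where
  "level_diff_sup q \<tau> = (SUP w\<in>words q. level_diff_inf q \<tau> w)"

end

(* Write H for the trigonometric mask of the digits, so that the Fourier transform of the Cantor
   measure satisfies ft x = H x * ft (x / b), and let P w x be the sum of |ft (x + l)|^2 over the
   frequencies l in the part of the tree below the word w. Since |H|^2 sums to 1 over a complete
   residue system mod q, the values P w x form a martingale along the tree: P w x is the
   probability that the random walk which moves from (w, x) to (wi, (x + tau(wi)) / b) with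
   probability |H(x + tau(wi))|^2 ends in a tail of zeros. If m is the infimum of P over |x| <= rad,
   and every node has one leaf that is reached with probability at least c, then
   1 - m <= (1 - m)(1 - c), so that P = 1.
   Such a leaf comes from the level differences. The only dangerous steps are those to a value
   of tau not divisible by q: there |H| is of the order of the current position, which
   shrinks by the factor b with every preceding zero; this cost is what the second summand of the
   level difference counts. The position at the start is bounded away from 0 after following zeros
   up to the first non-zero value.
   P = 1 puts every exponential into the closed span, and Stone-Weierstrass gives density. *)
theory Submission
  imports Defs
begin

section \<open>Exponentials and the Fourier transform of the Cantor measure\<close>

text \<open>The obstacle is that \<open>cmask q\<close> vanishes at every integer not divisible by
  q. Near position 0 a child whose value is not divisible by q is chosen with arbitrarily small
  probability, so a constant c valid for all nodes and positions cannot come from following an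
  arbitrary branch. The letter 0 helps: its value is divisible by q, hence its mask is at least |ft|
  at the current position, and if that value is non-zero the walk lands at distance at least
  \<open>sep\<close> from 0. Runs of zeros may be arbitrarily long, but their masks form a partial
  product of the infinite product for \<open>ft\<close>, which has no zero in (-1, 1). All positions
  stay in a compact part of that interval because the values lie between -1 and b - 2. There is no
  compactness over words, so c has to depend on the bound for the level differences alone. Arguments
  x outside the interval are treated separately, by the contraction of the walk.\<close>

lemma expo_conv_cis: "expo l x = cis (- (2 * pi * l * x))"
  by (simp add: expo_def cis_conv_exp mult_ac)

lemma expo_zero [simp]: "expo 0 x = 1" "expo l 0 = 1"
  by (simp_all add: expo_def)

lemma norm_expo [simp]: "cmod (expo l x) = 1"
  by (simp add: expo_conv_cis)

lemma cnj_expo: "cnj (expo l x) = expo (- l) x"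
  by (simp add: expo_conv_cis cis_cnj)

lemma expo_add: "expo (k + l) x = expo k x * expo l x"
  by (simp add: expo_conv_cis cis_mult algebra_simps)

lemma expo_mult_cnj: "expo k x * cnj (expo l x) = expo (k - l) x"
  by (simp add: cnj_expo expo_add [symmetric])

lemma expo_power: "expo l x ^ n = expo (real n * l) x"
  unfolding expo_conv_cis Complex.DeMoivre by (simp add: algebra_simps)

lemma continuous_on_expo [continuous_intros]: "continuous_on S (expo l)"
  unfolding expo_def by (intro continuous_intros)

lemma borel_measurable_expo [measurable]: "expo l \<in> borel_measurable borel"
  by (intro borel_measurable_continuous_onI continuous_intros)

lemma expo_eq_1_iff: "expo l 1 = 1 \<longleftrightarrow> l \<in> \<int>"
proof
  assume "expo l 1 = 1"
  then obtain n :: int where "- (2 * pi * l) = of_int (2 * n) * pi"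
    unfolding expo_conv_cis cis_conv_exp by (auto simp: exp_eq_1)
  then have "pi * l = pi * of_int (- n)" by simp
  then have "l = of_int (- n)" by (subst (asm) mult_cancel_left) simp
  then show "l \<in> \<int>" by (metis Ints_of_int)
next
  assume "l \<in> \<int>"
  then obtain n :: int where "l = of_int n" by (auto elim: Ints_cases)
  then show "expo l 1 = 1"
    unfolding expo_conv_cis cis_conv_exp by (auto simp: exp_eq_1 intro!: exI[of _ "-n"])
qed

section \<open>The mask of the digits and its zeros\<close>

definition cmask :: "nat \<Rightarrow> real \<Rightarrow> complex" where
  "cmask q x = (\<Sum>j<q. expo (x / real q) 1 ^ j) / of_nat q"

text \<open>A geometric sum kept free of division: it stays valid where both sides vanish, and it
  serves to locate the zeros of the mask as well as to bound its modulus below.\<close>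

lemma cmask_mult: "cmask q x * (1 - expo (x / real q) 1) = (1 - expo x 1) / of_nat q"
proof (cases "q = 0")
  case False
  then have "expo (x / real q) 1 ^ q = expo x 1" by (simp add: expo_power)
  then show ?thesis
    using one_diff_power_eq[of "expo (x / real q) 1" q] by (simp add: cmask_def mult_ac)
qed (simp add: cmask_def)

lemma cmask_zero [simp]: "0 < q \<Longrightarrow> cmask q 0 = 1"
  by (simp add: cmask_def)

lemma norm_cmask_le_1: "cmod (cmask q x) \<le> 1"
proof -
  have "cmod (\<Sum>j<q. expo (x / real q) 1 ^ j) \<le> (\<Sum>j<q. 1)"
    by (rule sum_norm_le) (simp add: norm_power)
  then show ?thesis by (cases "q = 0") (simp_all add: cmask_def norm_divide)
qed

lemma cmask_periodic:
  assumes "int q dvd k"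
  shows "cmask q (x + of_int k) = cmask q x"
proof (cases "q = 0")
  case False
  from assms obtain m where m: "k = int q * m" by blast
  have "expo ((x + of_int k) / real q) 1 = expo (x / real q) 1 * expo (of_int m) 1"
    unfolding m expo_add[symmetric] using False by (simp add: field_simps)
  also have "expo (of_int m) 1 = 1" by (simp add: expo_eq_1_iff)
  finally show ?thesis by (simp add: cmask_def)
qed (simp add: cmask_def)

lemma cmask_eq_0:
  assumes "0 < q" "\<not> int q dvd k"
  shows "cmask q (of_int k) = 0"
proof -
  have "of_int k / real q \<notin> \<int>"
  proof
    assume "of_int k / real q \<in> \<int>"
    then obtain m where "of_int k / real q = of_int m" by (auto elim: Ints_cases)
    then have "real_of_int k = of_int (int q * m)" using assms by (simp add: field_simps)
    then have "k = int q * m" by (simp only: of_int_eq_iff)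
    then show False using assms by simp
  qed
  moreover have "expo (of_int k) 1 = 1" by (simp add: expo_eq_1_iff)
  ultimately show ?thesis
    using cmask_mult[of q "of_int k"] expo_eq_1_iff[of "of_int k / real q"] by simp
qed

lemma cmask_nonzero:
  assumes "0 < q" "\<bar>x\<bar> < 1"
  shows "cmask q x \<noteq> 0"
proof
  assume 0: "cmask q x = 0"
  then have "expo x 1 = 1" using cmask_mult[of q x] assms by simp
  then obtain m where "x = of_int m" by (auto simp: expo_eq_1_iff elim: Ints_cases)
  with assms(2) have "x = 0" by simp
  with 0 assms show False by simp
qed

text \<open>Orthogonality of the characters j and k of Z/q: a geometric sum over a q-th root of
  unity other than 1 vanishes.\<close>

lemma sum_expo_roots:
  assumes "j < q" "k < q"
  shows "(\<Sum>i<q. expo (real i * (real j - real k) / real q) 1) = (if j = k then of_nat q else 0)"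
proof (cases "j = k")
  case False
  define z where "z = expo ((real j - real k) / real q) 1"
  have "z \<noteq> 1"
  proof
    assume "z = 1"
    then obtain m where "(real j - real k) / real q = of_int m"
      by (auto simp: z_def expo_eq_1_iff elim: Ints_cases)
    then have "real_of_int (int j - int k) = of_int (int q * m)" using assms by (simp add: field_simps)
    then have "int j - int k = int q * m" by (simp only: of_int_eq_iff)
    moreover have "\<bar>int j - int k\<bar> < int q" using assms by linarith
    moreover have "int j - int k \<noteq> 0" using False by simp
    ultimately show False using dvd_imp_le_int[of "int j - int k" "int q"] by simp
  qed
  moreover have "z ^ q = 1"
  proof -
    have "z ^ q = expo (of_int (int j - int k)) 1" using assms by (simp add: z_def expo_power)
    then show ?thesis by (simp only: expo_eq_1_iff Ints_of_int)
  qed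
  ultimately have "(\<Sum>i<q. z ^ i) = 0"
    by (simp add: geometric_sum)
  moreover have "z ^ i = expo (real i * (real j - real k) / real q) 1" for i
    by (simp add: z_def expo_power)
  ultimately show ?thesis using False by simp
qed simp

text \<open>Plancherel on Z/q. Expanding the squares gives a double sum over pairs of digits;
  summation over the shifts i kills every pair off the diagonal, and on the diagonal the phase in x
  disappears.\<close>

lemma sum_norm_cmask_shift:
  assumes "0 < q"
  shows "(\<Sum>i<q. (cmod (cmask q (x + real i)))\<^sup>2) = 1"
proof -
  let ?e = "\<lambda>a. expo a 1"
  have sq: "complex_of_real ((cmod (cmask q (x + real i)))\<^sup>2) =
      (\<Sum>j<q. \<Sum>k<q. ?e (x * (real j - real k) / real q) *
         ?e (real i * (real j - real k) / real q)) / (of_nat q)\<^sup>2" for i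
  proof -
    have "complex_of_real ((cmod (cmask q (x + real i)))\<^sup>2) =
        cmask q (x + real i) * cnj (cmask q (x + real i))"
      by (rule complex_norm_square)
    also have "\<dots> = (\<Sum>j<q. \<Sum>k<q. ?e (real j * ((x + real i) / real q)) *
        cnj (?e (real k * ((x + real i) / real q)))) / (of_nat q)\<^sup>2"
      by (simp add: cmask_def power2_eq_square expo_power sum_product)
    also have "\<dots> = (\<Sum>j<q. \<Sum>k<q. ?e (x * (real j - real k) / real q) *
         ?e (real i * (real j - real k) / real q)) / (of_nat q)\<^sup>2"
      unfolding expo_mult_cnj expo_add[symmetric]
      by (intro arg_cong2[where f = "(/)"] sum.cong refl arg_cong2[where f = expo])
         (simp add: field_simps add_divide_distrib[symmetric])
    finally show ?thesis .
  qed
  have "complex_of_real (\<Sum>i<q. (cmod (cmask q (x + real i)))\<^sup>2) =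
      (\<Sum>i<q. \<Sum>j<q. \<Sum>k<q. ?e (x * (real j - real k) / real q) *
         ?e (real i * (real j - real k) / real q)) / (of_nat q)\<^sup>2"
    by (simp only: of_real_sum sq sum_divide_distrib)
  also have "(\<Sum>i<q. \<Sum>j<q. \<Sum>k<q. ?e (x * (real j - real k) / real q) *
         ?e (real i * (real j - real k) / real q)) =
      (\<Sum>j<q. \<Sum>k<q. \<Sum>i<q. ?e (x * (real j - real k) / real q) *
         ?e (real i * (real j - real k) / real q))"
    by (rule trans[OF sum.swap]) (intro sum.cong refl sum.swap)
  also have "\<dots> = (\<Sum>j<q. \<Sum>k<q. ?e (x * (real j - real k) / real q) *
         (if j = k then of_nat q else 0))"
    by (intro sum.cong refl) (simp only: sum_distrib_left[symmetric] sum_expo_roots lessThan_iff)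
  also have "\<dots> = (\<Sum>j<q. \<Sum>k<q. if j = k then of_nat q else 0)"
    by (intro sum.cong refl) simp
  also have "\<dots> = (of_nat q)\<^sup>2"
    by (simp add: power2_eq_square)
  finally have "complex_of_real (\<Sum>i<q. (cmod (cmask q (x + real i)))\<^sup>2) = 1"
    using assms by simp
  then show ?thesis by (simp only: of_real_eq_1_iff)
qed

lemma sum_norm_cmask:
  assumes "0 < q" and t: "\<And>i. i < q \<Longrightarrow> int q dvd t i - int i"
  shows "(\<Sum>i<q. (cmod (cmask q (x + of_int (t i))))\<^sup>2) = 1"
proof -
  have "cmask q (x + of_int (t i)) = cmask q (x + real i)" if "i < q" for i
    using cmask_periodic[OF t[OF that], of "x + real i"] by simp
  then show ?thesis using sum_norm_cmask_shift[OF assms(1)] by simp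
qed

section \<open>The Fourier transform: recursion, zeros and lower bounds\<close>

definition ft :: "real measure \<Rightarrow> real \<Rightarrow> complex" where
  "ft M x = (LINT y|M. expo x y)"

lemma ft_eq_char: "ft M x = char M (- (2 * pi * x))"
  by (simp add: ft_def char_def expo_def mult_ac)

lemma cnj_ft: "cnj (ft M x) = ft M (- x)"
  unfolding ft_def cnj_expo[symmetric] by (rule Bochner_Integration.integral_cnj[where f = "expo x", symmetric])

lemma norm_ft_minus: "cmod (ft M (- x)) = cmod (ft M x)"
  by (metis cnj_ft complex_mod_cnj)

locale cantor =
  fixes q b :: nat and M :: "real measure"
  assumes q: "2 \<le> q" and qb: "q dvd b" and bq: "2 \<le> b div q" and M: "is_cantor_measure q b M"
begin

lemma b_ge_4: "4 \<le> b"
proof -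
  have "2 * 2 \<le> (b div q) * q" by (intro mult_mono q bq) auto
  then show ?thesis using qb by simp
qed

lemma real_distribution_M: "real_distribution M"
  using M by (auto simp: is_cantor_measure_def real_distribution_def real_distribution_axioms_def)

lemma ft_rec: "ft M x = cmask q x * ft M (x / real b)"
proof -
  have "(\<Sum>i<q. iexp (- (2 * pi * x) * real i / real q)) / q = cmask q x"
    unfolding cmask_def expo_power
    by (intro arg_cong2[where f = "(/)"] sum.cong refl) (simp add: expo_def mult_ac)
  then show ?thesis
    using char_is_cantor_measure[OF _ M, of "- (2 * pi * x)"] q by (simp add: ft_eq_char mult_ac)
qed

lemma ft_zero [simp]: "ft M 0 = 1"
proof -
  interpret real_distribution M by (rule real_distribution_M)
  show ?thesis by (simp add: ft_eq_char char_zero)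
qed

lemma norm_ft_le_1: "cmod (ft M x) \<le> 1"
proof -
  interpret real_distribution M by (rule real_distribution_M)
  show ?thesis by (simp add: ft_eq_char cmod_char_le_1)
qed

lemma isCont_ft: "isCont (ft M) x"
proof -
  interpret real_distribution M by (rule real_distribution_M)
  have *: "ft M = (\<lambda>x. char M (- (2 * pi * x)))" by (simp add: ft_eq_char fun_eq_iff)
  have "isCont (\<lambda>x. - (2 * pi * x)) x" by (intro continuous_intros)
  then show ?thesis unfolding * by (rule isCont_o2) (rule isCont_char)
qed

lemma norm_ft_le_cmask: "cmod (ft M x) \<le> cmod (cmask q x)"
  using norm_ft_le_1[of "x / real b"] by (subst ft_rec) (simp add: norm_mult mult_left_le)

lemma ft_prod: "ft M x = (\<Prod>k<n. cmask q (x / real b ^ k)) * ft M (x / real b ^ n)"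
proof (induction n)
  case (Suc n)
  have "ft M (x / real b ^ n) = cmask q (x / real b ^ n) * ft M (x / real b ^ Suc n)"
    using ft_rec[of "x / real b ^ n"] by (simp add: mult.commute)
  then show ?case using Suc by (simp add: mult.assoc)
qed simp

lemma norm_ft_le_prod: "cmod (ft M x) \<le> (\<Prod>k<n. cmod (cmask q (x / real b ^ k)))"
  using norm_ft_le_1[of "x / real b ^ n"]
  by (subst ft_prod[of _ n]) (simp add: norm_mult prod_norm[symmetric] mult_left_le prod_nonneg)

lemma divide_power_tendsto_0: "(\<lambda>n. x / real b ^ n) \<longlonglongrightarrow> 0"
  using b_ge_4 tendsto_mult_right_zero[OF LIMSEQ_inverse_realpow_zero[of "real b"], of x]
  by (simp add: divide_inverse)

text \<open>No infinite product has to be estimated: continuity at 0 gives one n for which the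
  remainder factor in \<open>ft_prod\<close> is non-zero, and the finitely many masks before it have
  no zero in (-1, 1).\<close>

lemma ft_nonzero:
  assumes "\<bar>x\<bar> < 1"
  shows "ft M x \<noteq> 0"
proof -
  have "(\<lambda>n. ft M (x / real b ^ n)) \<longlonglongrightarrow> ft M 0"
    by (rule isCont_tendsto_compose[OF isCont_ft divide_power_tendsto_0])
  then have "\<forall>\<^sub>F n in sequentially. ft M (x / real b ^ n) \<noteq> 0"
    by (rule tendsto_imp_eventually_ne) simp
  then obtain n where n: "ft M (x / real b ^ n) \<noteq> 0"
    by (auto simp: eventually_sequentially)
  have "cmask q (x / real b ^ k) \<noteq> 0" for k
  proof (rule cmask_nonzero)
    have "\<bar>x\<bar> / real b ^ k \<le> \<bar>x\<bar>"
      using b_ge_4 by (simp add: divide_le_eq mult_le_cancel_left1)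
    then show "\<bar>x / real b ^ k\<bar> < 1" using assms by simp
  qed (use q in simp)
  then show ?thesis using n by (subst ft_prod[of _ n]) simp
qed

text \<open>The recursion strips off one factor b after the other until the integer k itself is the
  argument of the mask, which vanishes there. This is the source of orthogonality.\<close>

lemma ft_eq_0:
  assumes "\<not> int q dvd k"
  shows "ft M (of_int k * real b ^ n) = 0"
proof (induction n)
  case 0
  show ?case using cmask_eq_0[of q k] assms q by (subst ft_rec) simp
next
  case (Suc n)
  have "of_int k * real b ^ Suc n / real b = of_int k * real b ^ n" using b_ge_4 by simp
  then show ?case using Suc by (subst ft_rec) simp
qed

lemma ft_lower_bound:
  assumes "0 \<le> r" "r < 1"
  obtains \<kappa> where "0 < \<kappa>" "\<kappa> \<le> 1" "\<And>x. \<bar>x\<bar> \<le> r \<Longrightarrow> \<kappa> \<le> cmod (ft M x)"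
proof -
  have "continuous_on {-r..r} (\<lambda>x. cmod (ft M x))"
    by (intro continuous_intros continuous_at_imp_continuous_on ballI isCont_ft)
  then obtain y where y: "y \<in> {-r..r}" "\<And>x. x \<in> {-r..r} \<Longrightarrow> cmod (ft M y) \<le> cmod (ft M x)"
    using continuous_attains_inf[of "{-r..r}" "\<lambda>x. cmod (ft M x)"] assms by auto
  show thesis
  proof (rule that[of "cmod (ft M y)"])
    show "0 < cmod (ft M y)" using y(1) assms ft_nonzero[of y] by (simp add: abs_le_iff abs_less_iff)
    show "cmod (ft M y) \<le> 1" by (rule norm_ft_le_1)
    show "cmod (ft M y) \<le> cmod (ft M x)" if "\<bar>x\<bar> \<le> r" for x
      by (rule y(2)) (use that in auto)
  qed
qed

end

section \<open>Mass of the tree\<close>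

lemma abs_sin_ge:
  assumes "\<bar>x\<bar> \<le> pi / 2"
  shows "\<bar>x\<bar> / 3 \<le> \<bar>sin x\<bar>"
proof -
  have x2: "\<bar>x\<bar> \<le> 2" using assms pi_less_4 by linarith
  have "\<bar>sin x - x\<bar> \<le> \<bar>x\<bar> ^ 3 / 6"
  proof -
    have "(\<Sum>m<3. sin_coeff m * x ^ m) = x" by (simp add: numeral_3_eq_3 sin_coeff_def)
    moreover have "inverse (fact 3) = (1 / 6 :: real)" by (simp add: fact_numeral)
    ultimately have "\<bar>sin x - x\<bar> \<le> 1 / 6 * \<bar>x\<bar> ^ 3"
      using Maclaurin_sin_bound[of x 3] by (simp only:)
    then show ?thesis by simp
  qed
  moreover have "\<bar>x\<bar> ^ 3 \<le> 4 * \<bar>x\<bar>"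
    using mult_right_mono[OF mult_mono[OF x2 x2], of "\<bar>x\<bar>"] unfolding power3_eq_cube by linarith
  ultimately have "\<bar>sin x - x\<bar> \<le> 4 * \<bar>x\<bar> / 6" by linarith
  then show ?thesis by linarith
qed

lemma norm_one_minus_expo: "cmod (1 - expo x 1) = 2 * \<bar>sin (pi * x)\<bar>"
proof -
  have "cmod (1 - expo x 1) = cmod (exp (\<i> * of_real (- (2 * pi * x))) - 1)"
    by (simp add: expo_conv_cis cis_conv_exp norm_minus_commute)
  also have "\<dots> = 2 * \<bar>sin (- (pi * x))\<bar>"
    by (subst dist_exp_i_1) simp
  finally show ?thesis by simp
qed

text \<open>With d(y) = |1 - expo y 1| the geometric sum reads |H(y)| d(y / q) = d(y) / q. Since d
  has period 1, the right-hand side is the same at x and x + t, and d \<le> 2 bounds the mask at x +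
  t below by a multiple of d(x), hence of |x|. No bound better than linear can hold, since the mask
  vanishes at t unless q divides t.\<close>

lemma (in cantor) bounds:
  assumes r: "0 \<le> r" "r < 1"
  obtains \<kappa> where "0 < \<kappa>" "\<kappa> \<le> 1" "\<And>x. \<bar>x\<bar> \<le> r \<Longrightarrow> \<kappa> \<le> cmod (ft M x)"
    "\<And>x t. \<bar>x\<bar> \<le> r \<Longrightarrow> \<kappa> * \<bar>x\<bar> \<le> cmod (cmask q (x + of_int t))"
proof -
  obtain \<kappa> where \<kappa>: "0 < \<kappa>" "\<kappa> \<le> 1" "\<And>x. \<bar>x\<bar> \<le> r \<Longrightarrow> \<kappa> \<le> cmod (ft M x)"
    using ft_lower_bound[OF r] by blast
  define \<kappa>' where "\<kappa>' = \<kappa> / (3 * real q)"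
  have "\<kappa>' \<le> \<kappa> / 1" unfolding \<kappa>'_def using \<kappa> q by (intro divide_left_mono) auto
  then have le: "\<kappa>' \<le> \<kappa>" by simp
  show thesis
  proof (rule that[of \<kappa>'])
    show "0 < \<kappa>'" using \<kappa> q by (simp add: \<kappa>'_def)
    show "\<kappa>' \<le> 1" "\<And>x. \<bar>x\<bar> \<le> r \<Longrightarrow> \<kappa>' \<le> cmod (ft M x)"
      using le \<kappa>(2) \<kappa>(3) by force+
    fix x :: real and t :: int
    assume x: "\<bar>x\<bar> \<le> r"
    let ?d = "\<lambda>y. cmod (1 - expo y 1)"
    have q0: "0 < real q" using q by simp
    have per: "?d (x + of_int t) = ?d x"
      using expo_eq_1_iff[of "of_int t"] by (simp add: expo_add)
    have eq: "cmod (cmask q y) * ?d (y / real q) = ?d y / real q" for y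
      using arg_cong[OF cmask_mult[of q y], of cmod] by (simp add: norm_mult norm_divide)
    \<comment> \<open>The sine is estimated at x / q rather than at x: |x| may be close to 1,
      whereas |x| / q \<le> 1/2. The factor |H(x)| \<ge> \<kappa> leads back to x.\<close>
    have xq: "\<bar>x\<bar> / real q \<le> 1 / 2"
      using frac_le[of 1 "\<bar>x\<bar>" 2 "real q"] x r q by simp
    then have "\<bar>pi * (x / real q)\<bar> \<le> pi / 2"
      using mult_left_mono[OF xq, of pi] by (simp add: abs_mult)
    from abs_sin_ge[OF this] have "pi * \<bar>x\<bar> / (3 * real q) \<le> \<bar>sin (pi * (x / real q))\<bar>"
      by (simp add: abs_mult mult_ac)
    moreover have "1 * \<bar>x\<bar> / (3 * real q) \<le> pi * \<bar>x\<bar> / (3 * real q)"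
      using pi_gt3 q0 by (intro divide_right_mono mult_right_mono) auto
    ultimately have "2 * \<bar>x\<bar> / (3 * real q) \<le> ?d (x / real q)"
      unfolding norm_one_minus_expo by simp
    then have "\<kappa> * (2 * \<bar>x\<bar> / (3 * real q)) \<le> cmod (cmask q x) * ?d (x / real q)"
      using \<kappa>(1) order_trans[OF \<kappa>(3)[OF x] norm_ft_le_cmask] by (intro mult_mono) auto
    then have "2 * (\<kappa>' * \<bar>x\<bar>) \<le> ?d x / real q"
      unfolding eq by (simp add: \<kappa>'_def mult_ac)
    also have "\<dots> = cmod (cmask q (x + of_int t)) * ?d ((x + of_int t) / real q)"
      unfolding eq per ..
    also have "\<dots> \<le> cmod (cmask q (x + of_int t)) * 2"
      using norm_triangle_ineq4[of 1 "expo ((x + of_int t) / real q) 1"]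
      by (intro mult_left_mono) auto
    finally show "\<kappa>' * \<bar>x\<bar> \<le> cmod (cmask q (x + of_int t))" by simp
  qed
qed

text \<open>The second summand of the level difference as a recursion along the list of positions,
  with the previous position \<open>p\<close> as an argument; an induction over the blocks of a
  branch can carry it along.\<close>

fun gaps :: "nat set \<Rightarrow> nat \<Rightarrow> nat list \<Rightarrow> nat" where
  "gaps B p [] = 0"
| "gaps B p (n # l) = (if n \<in> B then n - p - 1 else 0) + gaps B n l"

lemma gaps_eq_sum:
  "gaps B p l =
     (\<Sum>j\<in>{j\<in>{1..length l}. (p # l) ! j \<in> B}. (p # l) ! j - (p # l) ! (j - 1) - 1)"
proof (induction l arbitrary: p)
  case (Cons n l)
  have *: "(\<Sum>j\<in>{j\<in>{1..k}. ns ! j \<in> B}. ns ! j - ns ! (j - 1) - 1) =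
      (\<Sum>j<k. if ns ! Suc j \<in> B then ns ! Suc j - ns ! j - 1 else 0)" for ns :: "nat list" and k
  proof -
    have "(\<Sum>j\<in>{j\<in>{1..k}. ns ! j \<in> B}. ns ! j - ns ! (j - 1) - 1) =
        (\<Sum>j\<in>{1..k}. if ns ! j \<in> B then ns ! j - ns ! (j - 1) - 1 else 0)"
      by (rule sum.inter_filter) simp
    also have "\<dots> = (\<Sum>j<k. if ns ! Suc j \<in> B then ns ! Suc j - ns ! j - 1 else 0)"
      by (rule sum.reindex_bij_witness[of _ Suc "\<lambda>j. j - 1"]) auto
    finally show ?thesis .
  qed
  show ?case
    using Cons[of n] unfolding * by (simp add: sum.lessThan_Suc_shift del: sum.lessThan_Suc cong: if_cong)
qed simp

lemma level_diff_leD: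
  assumes "level_diff q \<tau> w w' \<le> enat d"
  shows "finite (level_A \<tau> w w')"
    and "card (level_A \<tau> w w') + gaps (level_B q \<tau> w w') 0 (sorted_list_of_set (level_A \<tau> w w')) \<le> d"
proof -
  show fin: "finite (level_A \<tau> w w')"
  proof (rule ccontr)
    assume "infinite (level_A \<tau> w w')"
    then have "level_diff q \<tau> w w' = \<infinity>"
      unfolding level_diff_def Let_def by (simp only: if_False)
    then show False using assms by simp
  qed
  show "card (level_A \<tau> w w') + gaps (level_B q \<tau> w w') 0 (sorted_list_of_set (level_A \<tau> w w')) \<le> d"
    using assms fin unfolding level_diff_def Let_def gaps_eq_sum by simp
qed

lemma pref_Suc: "pref w (Suc n) = pref w n @ [if n < length w then w ! n else 0]"
proof (cases "n < length w")
  case True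
  then show ?thesis by (simp add: pref_def take_Suc_conv_app_nth)
next
  case False
  then show ?thesis by (simp add: pref_def Suc_diff_le replicate_append_same)
qed

lemma pref_0 [simp]: "pref w 0 = []"
  by (simp add: pref_def)

lemma pref_add: "length w \<le> n \<Longrightarrow> pref w (n + k) = pref w n @ replicate k 0"
  by (simp add: pref_def replicate_add[symmetric])

lemma length_pref [simp]: "length (pref w n) = n"
  by (simp add: pref_def)

lemma set_pref: "set w \<subseteq> {..<q} \<Longrightarrow> 0 < q \<Longrightarrow> set (pref w n) \<subseteq> {..<q}"
  by (auto simp: pref_def dest: in_set_takeD)

section \<open>The walk on the tree and the mass of its leaves\<close>

locale cantor_tree = cantor +
  fixes \<tau> :: "nat list \<Rightarrow> int"
  assumes tree: "tree_mapping q b \<tau>"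
begin

text \<open>Unlike \<open>words q\<close> it admits the empty word: the walk starts at the
  root.\<close>

abbreviation "word w \<equiv> set w \<subseteq> {..<q}"

definition weight :: "nat list \<Rightarrow> real \<Rightarrow> real" where
  "weight w x = (cmod (cmask q (x + of_int (\<tau> w))))\<^sup>2"

definition step :: "nat list \<Rightarrow> real \<Rightarrow> real" where
  "step w x = (x + of_int (\<tau> w)) / real b"

text \<open>The value at \<open>w\<close> itself is left out (k \<ge> 1): it has already entered the
  position of a walk that stands at \<open>w\<close>.\<close>

definition zero_tail :: "nat list \<Rightarrow> bool" where
  "zero_tail w \<longleftrightarrow> (\<forall>k\<ge>1. \<tau> (w @ replicate k 0) = 0)"

text \<open>The mass seen after n levels. The leaf value |ft x|^2 is the product of |H(x / b^k)|^2
  over all k, that is, the probability of taking the letter 0 forever when all values ahead are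
  0.\<close>

primrec leaf_mass :: "nat \<Rightarrow> nat list \<Rightarrow> real \<Rightarrow> real" where
  "leaf_mass 0 w x = (if zero_tail w then (cmod (ft M x))\<^sup>2 else 0)"
| "leaf_mass (Suc n) w x =
     (\<Sum>i<q. weight (w @ [i]) x * leaf_mass n (w @ [i]) (step (w @ [i]) x))"

definition mass :: "nat list \<Rightarrow> real \<Rightarrow> real" where
  "mass w x = (SUP n. leaf_mass n w x)"

lemma q_pos: "0 < q" using q by simp

lemma tree_range: "word w \<Longrightarrow> w \<noteq> [] \<Longrightarrow> -1 \<le> \<tau> w \<and> \<tau> w \<le> int b - 2"
  using tree by (auto simp: tree_mapping_def words_def)

lemma tree_abs: "word w \<Longrightarrow> w \<noteq> [] \<Longrightarrow> \<bar>real_of_int (\<tau> w)\<bar> \<le> real b - 2"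
proof -
  assume "word w" "w \<noteq> []"
  from tree_range[OF this] have "\<bar>\<tau> w\<bar> \<le> int b - 2" using b_ge_4 by auto
  then have "real_of_int \<bar>\<tau> w\<bar> \<le> real_of_int (int b - 2)" by (simp only: of_int_le_iff)
  then show ?thesis by simp
qed

lemma tree_residue: "word w \<Longrightarrow> i < q \<Longrightarrow> int q dvd \<tau> (w @ [i]) - int i"
proof -
  assume "word w" "i < q"
  then have "w @ [i] \<in> words q" by (auto simp: words_def)
  then obtain k where "\<tau> (w @ [i]) = int (last (w @ [i])) + int q * k"
    using tree unfolding tree_mapping_def by blast
  then show ?thesis by simp
qed

lemma zero_tail_snoc:
  assumes "zero_tail w"
  shows "zero_tail (w @ [0])" "\<tau> (w @ [0]) = 0"
proof -
  have "\<tau> (w @ [0] @ replicate k 0) = 0" for k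
    using assms[unfolded zero_tail_def, rule_format, of "Suc k"] by simp
  from this[of 0] this show "zero_tail (w @ [0])" "\<tau> (w @ [0]) = 0"
    by (auto simp: zero_tail_def)
qed

lemma weight_nonneg: "0 \<le> weight w x" by (simp add: weight_def)

lemma weight_le_1: "weight w x \<le> 1"
  by (simp add: weight_def power_le_one norm_cmask_le_1)

lemma sum_weight: "word w \<Longrightarrow> (\<Sum>i<q. weight (w @ [i]) x) = 1"
  unfolding weight_def by (rule sum_norm_cmask[OF q_pos tree_residue])

lemma leaf_mass_nonneg: "0 \<le> leaf_mass n w x"
  by (induction n arbitrary: w x) (auto intro!: sum_nonneg mult_nonneg_nonneg weight_nonneg)

text \<open>Bessel's inequality in probabilistic form: it comes from the weights of the children
  adding up to 1, not from orthogonality.\<close>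

lemma leaf_mass_le_1: "word w \<Longrightarrow> leaf_mass n w x \<le> 1"
proof (induction n arbitrary: w x)
  case 0
  then show ?case by (simp add: power_le_one norm_ft_le_1)
next
  case (Suc n)
  have "leaf_mass (Suc n) w x \<le> (\<Sum>i<q. weight (w @ [i]) x * 1)"
    unfolding leaf_mass.simps using Suc.prems
    by (intro sum_mono mult_left_mono weight_nonneg Suc.IH) auto
  then show ?case using sum_weight[OF Suc.prems] by simp
qed

text \<open>A leaf is counted again one level deeper, with the same contribution, through its child
  with letter 0: there the weight times the new leaf value is the square of \<open>ft_rec\<close>.
  Other leaves can only be added.\<close>

lemma leaf_mass_mono: "word w \<Longrightarrow> leaf_mass n w x \<le> leaf_mass (Suc n) w x"
proof (induction n arbitrary: w x)
  case 0
  show ?case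
  proof (cases "zero_tail w")
    case True
    have "(cmod (ft M x))\<^sup>2 = weight (w @ [0]) x * leaf_mass 0 (w @ [0]) (step (w @ [0]) x)"
      using zero_tail_snoc[OF True]
      by (subst ft_rec) (simp add: weight_def step_def norm_mult power_mult_distrib)
    also have "\<dots> \<le> leaf_mass (Suc 0) w x"
      unfolding leaf_mass.simps(2)
      by (rule member_le_sum[of 0]) (use q_pos in \<open>auto intro!: mult_nonneg_nonneg weight_nonneg\<close>)
    finally show ?thesis using True by simp
  next
    case False
    then show ?thesis using leaf_mass_nonneg[of "Suc 0" w x] by simp
  qed
next
  case (Suc n)
  show ?case
    unfolding leaf_mass.simps(2)[of "Suc n"] unfolding leaf_mass.simps(2)[of n]
    using Suc.prems
    by (intro sum_mono mult_left_mono weight_nonneg Suc.IH[unfolded leaf_mass.simps(2)]) auto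
qed

lemma leaf_mass_tendsto: "word w \<Longrightarrow> (\<lambda>n. leaf_mass n w x) \<longlonglongrightarrow> mass w x"
  unfolding mass_def
  by (rule LIMSEQ_incseq_SUP)
     (auto intro!: bdd_aboveI[of _ 1] leaf_mass_le_1 incseq_SucI leaf_mass_mono)

lemma mass_le_1: "word w \<Longrightarrow> mass w x \<le> 1"
  by (rule LIMSEQ_le_const2[OF leaf_mass_tendsto]) (auto intro: leaf_mass_le_1)

lemma mass_nonneg: "word w \<Longrightarrow> 0 \<le> mass w x"
  by (rule LIMSEQ_le_const[OF leaf_mass_tendsto]) (auto intro: leaf_mass_nonneg)

lemma mass_zero_tail:
  assumes "word w" "zero_tail w"
  shows "(cmod (ft M x))\<^sup>2 \<le> mass w x"
proof (rule LIMSEQ_le_const[OF leaf_mass_tendsto])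
  have "leaf_mass 0 w x \<le> leaf_mass n w x" for n
    using lift_Suc_mono_le[of "\<lambda>n. leaf_mass n w x" 0 n] leaf_mass_mono[OF assms(1)] by simp
  then show "\<exists>N. \<forall>n\<ge>N. (cmod (ft M x))\<^sup>2 \<le> leaf_mass n w x" using assms(2) by simp
qed (rule assms)

lemma mass_rec:
  assumes "word w"
  shows "mass w x = (\<Sum>i<q. weight (w @ [i]) x * mass (w @ [i]) (step (w @ [i]) x))"
proof (rule LIMSEQ_unique)
  show "(\<lambda>n. leaf_mass (Suc n) w x) \<longlonglongrightarrow> mass w x"
    by (rule LIMSEQ_Suc[OF leaf_mass_tendsto[OF assms]])
  show "(\<lambda>n. leaf_mass (Suc n) w x) \<longlonglongrightarrow>
      (\<Sum>i<q. weight (w @ [i]) x * mass (w @ [i]) (step (w @ [i]) x))"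
    unfolding leaf_mass.simps(2)
    by (intro tendsto_sum tendsto_mult tendsto_const leaf_mass_tendsto) (use assms in auto)
qed

text \<open>The midpoint between 1 and (b - 2) / (b - 1), the fixed point of t \<mapsto> (t + b - 2)
  / b. Being above the fixed point makes the interval invariant under \<open>step\<close>; being
  below 1 keeps \<open>ft\<close> away from 0.\<close>

definition rad :: real where "rad = 1 - 1 / (2 * (real b - 1))"
text \<open>This is (1 - rad) / b: a non-zero integer value moves |x| \<le> rad to distance at least
  1 - rad from 0, and \<open>step\<close> divides by b.\<close>

definition sep :: real where "sep = 1 / (2 * (real b - 1) * real b)"

lemma rad: "0 \<le> rad" "rad < 1"
  using b_ge_4 by (auto simp: rad_def field_simps)

lemma sep_pos: "0 < sep"
  using b_ge_4 by (simp add: sep_def)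

lemma sep_le_1: "sep \<le> 1"
proof -
  have "1 * 1 \<le> (2 * (real b - 1)) * real b" using b_ge_4 by (intro mult_mono) auto
  then show ?thesis by (simp add: sep_def)
qed

lemma step_rad:
  assumes "word w" "w \<noteq> []" "\<bar>x\<bar> \<le> rad"
  shows "\<bar>step w x\<bar> \<le> rad"
proof -
  have "\<bar>x + of_int (\<tau> w)\<bar> \<le> rad + (real b - 2)"
    using tree_abs[OF assms(1,2)] assms(3) by linarith
  also have "\<dots> \<le> rad * real b"
  proof -
    have "rad * (real b - 1) = (real b - 1) - 1 / 2"
    proof -
      define c where "c = real b - 1"
      have "0 < c" using b_ge_4 by (simp add: c_def)
      then show ?thesis unfolding rad_def c_def[symmetric] by (simp add: field_simps)
    qed
    then show ?thesis by (simp add: right_diff_distrib)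
  qed
  finally show ?thesis
    using b_ge_4 by (simp add: step_def divide_le_eq)
qed

lemma step_sep:
  assumes "\<tau> w \<noteq> 0" "\<bar>x\<bar> \<le> rad"
  shows "sep \<le> \<bar>step w x\<bar>"
proof -
  have "1 \<le> \<bar>real_of_int (\<tau> w)\<bar>" using assms(1) by linarith
  then have "1 - rad \<le> \<bar>x + of_int (\<tau> w)\<bar>" using assms(2) by linarith
  then have "(1 - rad) / real b \<le> \<bar>step w x\<bar>"
    unfolding step_def using b_ge_4 by (simp add: divide_right_mono)
  then show ?thesis by (simp add: rad_def sep_def)
qed

text \<open>The true value is kept along one chosen branch; all other branches are estimated by the
  worst defect \<open>1 - m\<close>.\<close>

lemma mass_defect_step:
  assumes m: "\<And>v y. word v \<Longrightarrow> \<bar>y\<bar> \<le> rad \<Longrightarrow> m \<le> mass v y"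
    and w: "word w" "i < q" "\<bar>x\<bar> \<le> rad"
  shows "1 - mass w x \<le> (1 - m) * (1 - weight (w @ [i]) x) +
           weight (w @ [i]) x * (1 - mass (w @ [i]) (step (w @ [i]) x))"
proof -
  let ?g = "\<lambda>j. weight (w @ [j]) x * (1 - mass (w @ [j]) (step (w @ [j]) x))"
  have "1 - mass w x = (\<Sum>j<q. ?g j)"
    unfolding mass_rec[OF w(1)] by (simp add: algebra_simps sum_subtractf sum_weight[OF w(1)])
  also have "\<dots> = ?g i + (\<Sum>j\<in>{..<q}-{i}. ?g j)"
    using w by (intro sum.remove) auto
  also have "(\<Sum>j\<in>{..<q}-{i}. ?g j) \<le> (\<Sum>j\<in>{..<q}-{i}. weight (w @ [j]) x * (1 - m))"
    using w by (intro sum_mono mult_left_mono weight_nonneg diff_left_mono m step_rad) auto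
  also have "\<dots> = (1 - m) * ((\<Sum>j<q. weight (w @ [j]) x) - weight (w @ [i]) x)"
    using w by (simp add: sum_diff1 sum_distrib_right[symmetric])
  also have "(\<Sum>j<q. weight (w @ [j]) x) = 1" by (rule sum_weight[OF w(1)])
  finally show ?thesis by (simp add: algebra_simps)
qed

end

section \<open>One infinite branch \<open>V\<close> with its letters \<open>s\<close> and the
  positions \<open>X\<close> of the walk\<close>

locale cantor_path = cantor_tree +
  fixes V :: "nat \<Rightarrow> nat list" and s :: "nat \<Rightarrow> nat" and X :: "nat \<Rightarrow> real"
  assumes V0: "word (V 0)" and V_Suc: "V (Suc n) = V n @ [s n]" and s: "s n < q"
    and X0: "\<bar>X 0\<bar> \<le> rad" and X_Suc: "X (Suc n) = step (V (Suc n)) (X n)"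
begin

lemma word_V: "word (V n)"
  by (induction n) (use V0 V_Suc s in auto)

lemma X_rad: "\<bar>X n\<bar> \<le> rad"
proof (induction n)
  case (Suc n)
  show ?case
    unfolding X_Suc by (rule step_rad[OF word_V _ Suc]) (simp add: V_Suc)
qed (rule X0)

abbreviation "wt n \<equiv> weight (V (Suc n)) (X n)"

text \<open>The product of the weights is the probability of staying on the branch for n steps.
  Wherever the walk leaves it, the remaining defect is at most 1 - m, and all exits together have
  probability 1 minus the product.\<close>

lemma mass_defect_path:
  assumes m: "\<And>v y. word v \<Longrightarrow> \<bar>y\<bar> \<le> rad \<Longrightarrow> m \<le> mass v y"
  shows "1 - mass (V 0) (X 0) \<le> (1 - m) * (1 - (\<Prod>j<n. wt j)) +
           (\<Prod>j<n. wt j) * (1 - mass (V n) (X n))"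
proof (induction n)
  case (Suc n)
  define P where "P = (\<Prod>j<n. wt j)"
  have P: "0 \<le> P" unfolding P_def by (intro prod_nonneg ballI weight_nonneg)
  have "1 - mass (V n) (X n) \<le> (1 - m) * (1 - wt n) + wt n * (1 - mass (V (Suc n)) (X (Suc n)))"
    using mass_defect_step[OF m word_V s X_rad] unfolding X_Suc V_Suc by simp
  from mult_left_mono[OF this P] Suc
  have "1 - mass (V 0) (X 0) \<le> (1 - m) * (1 - P) +
      P * ((1 - m) * (1 - wt n) + wt n * (1 - mass (V (Suc n)) (X (Suc n))))"
    unfolding P_def by linarith
  then show ?case by (simp add: P_def[symmetric] algebra_simps)
qed simp

text \<open>While the values are 0 the position is only divided by b, so the masks met are the
  initial factors of the infinite product for ft (X p). The bound is therefore independent of the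
  length of the run.\<close>

lemma zero_run:
  assumes "p \<le> N" "\<And>n. p < n \<Longrightarrow> n \<le> N \<Longrightarrow> \<tau> (V n) = 0"
  shows "X N = X p / real b ^ (N - p)"
    and "cmod (ft M (X p)) \<le> (\<Prod>j\<in>{p..<N}. cmod (cmask q (X j + of_int (\<tau> (V (Suc j))))))"
proof -
  have X: "X (p + k) = X p / real b ^ k" if "p + k \<le> N" for k
    using that by (induction k) (simp_all add: X_Suc step_def assms(2) mult.commute)
  from X[of "N - p"] show "X N = X p / real b ^ (N - p)" using assms(1) by simp
  have "X j + of_int (\<tau> (V (Suc j))) = X p / real b ^ (j - p)" if "p \<le> j" "j < N" for j
    using X[of "j - p"] assms(2)[of "Suc j"] that by simp
  note eq = this
  have "(\<Prod>j\<in>{p..<N}. cmod (cmask q (X j + of_int (\<tau> (V (Suc j)))))) =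
      (\<Prod>k<N - p. cmod (cmask q (X p / real b ^ k)))"
    by (rule prod.reindex_bij_witness[of _ "\<lambda>k. p + k" "\<lambda>j. j - p"])
       (use assms(1) in \<open>auto simp: less_diff_conv2 eq\<close>)
  then show "cmod (ft M (X p)) \<le> (\<Prod>j\<in>{p..<N}. cmod (cmask q (X j + of_int (\<tau> (V (Suc j))))))"
    using norm_ft_le_prod[of "X p" "N - p"] by simp
qed

text \<open>Stopping at N would cost the extra defect 1 - |ft (X N)|^2. Continuing along the zeros
  drives the position to 0 and \<open>ft\<close> to 1, so this cost disappears in the limit, while
  the probability of the branch stays at least c.\<close>

lemma mass_defect_leaf:
  assumes m: "\<And>v y. word v \<Longrightarrow> \<bar>y\<bar> \<le> rad \<Longrightarrow> m \<le> mass v y"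
    and tail: "\<And>n. N \<le> n \<Longrightarrow> zero_tail (V n)" "\<And>n. N < n \<Longrightarrow> \<tau> (V n) = 0"
    and c: "\<And>n. N \<le> n \<Longrightarrow> c \<le> (\<Prod>j<n. wt j)"
  shows "1 - mass (V 0) (X 0) \<le> (1 - m) * (1 - c)"
proof -
  have m1: "m \<le> 1"
    using m[OF V0 X0] mass_le_1[OF V0] by (rule order_trans)
  have "(\<lambda>k. X (N + k)) = (\<lambda>k. X N / real b ^ k)"
    using zero_run(1)[of N "N + _"] tail(2) by fastforce
  then have "(\<lambda>k. X (N + k)) \<longlonglongrightarrow> 0"
    using divide_power_tendsto_0[of "X N"] by simp
  then have "(\<lambda>k. ft M (X (N + k))) \<longlonglongrightarrow> ft M 0"
    by (rule isCont_tendsto_compose[OF isCont_ft])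
  then have "(\<lambda>k. (1 - m) * (1 - c) + (1 - (cmod (ft M (X (N + k))))\<^sup>2))
      \<longlonglongrightarrow> (1 - m) * (1 - c) + (1 - (cmod (ft M 0))\<^sup>2)"
    by (intro tendsto_intros)
  then have lim: "(\<lambda>k. (1 - m) * (1 - c) + (1 - (cmod (ft M (X (N + k))))\<^sup>2))
      \<longlonglongrightarrow> (1 - m) * (1 - c)"
    by simp
  show ?thesis
  proof (rule LIMSEQ_le_const[OF lim], intro exI allI impI)
    fix k
    define P where "P = (\<Prod>j<N + k. wt j)"
    have P: "0 \<le> P" "P \<le> 1" unfolding P_def
      by (intro prod_nonneg prod_le_1 ballI conjI weight_nonneg weight_le_1)+
    have "c \<le> P" unfolding P_def by (rule c) simp
    then have others: "(1 - m) * (1 - P) \<le> (1 - m) * (1 - c)"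
      using m1 by (intro mult_left_mono) auto
    have "P * (1 - mass (V (N + k)) (X (N + k))) \<le> 1 * (1 - (cmod (ft M (X (N + k))))\<^sup>2)"
      using P mass_zero_tail[OF word_V tail(1)[of "N + k"], of "X (N + k)"] mass_le_1[OF word_V]
      by (intro mult_mono) auto
    then have branch: "P * (1 - mass (V (N + k)) (X (N + k))) \<le> 1 - (cmod (ft M (X (N + k))))\<^sup>2"
      by simp
    have "1 - mass (V 0) (X 0) \<le> (1 - m) * (1 - P) + P * (1 - mass (V (N + k)) (X (N + k)))"
      unfolding P_def by (rule mass_defect_path) (rule m)
    also have "\<dots> \<le> (1 - m) * (1 - c) + (1 - (cmod (ft M (X (N + k))))\<^sup>2)"
      by (rule add_mono[OF others branch])
    finally show "1 - mass (V 0) (X 0) \<le> (1 - m) * (1 - c) + (1 - (cmod (ft M (X (N + k))))\<^sup>2)" .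
  qed
qed

text \<open>The branch is cut behind every non-zero value. A block is a run of zeros, costing
  \<kappa>, and one step to the non-zero value, costing at worst \<kappa> * sep / b^g, where g is
  the gap for a position in \<open>B\<close> and 0 otherwise. Afterwards the position is again at
  least \<open>sep\<close>, so the next block starts under the same assumption. The leading \<kappa>
  pays for the final run of zeros.\<close>

lemma prod_blocks:
  assumes \<kappa>: "0 < \<kappa>" "\<kappa> \<le> 1" "\<And>x. \<bar>x\<bar> \<le> rad \<Longrightarrow> \<kappa> \<le> cmod (ft M x)"
      "\<And>x t. \<bar>x\<bar> \<le> rad \<Longrightarrow> \<kappa> * \<bar>x\<bar> \<le> cmod (cmask q (x + of_int t))"
    and B: "\<And>n. n \<in> set l \<Longrightarrow> n \<notin> B \<Longrightarrow> int q dvd \<tau> (V n)"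
    and l: "sorted_wrt (<) (p # l)" "set l = {n. p < n \<and> \<tau> (V n) \<noteq> 0}"
    and sep: "sep \<le> \<bar>X p\<bar>" and N: "p \<le> N" "\<And>n. n \<in> set l \<Longrightarrow> n \<le> N"
  shows "\<kappa> * (\<kappa>\<^sup>2 * sep) ^ length l / real b ^ gaps B p l \<le>
      (\<Prod>j\<in>{p..<N}. cmod (cmask q (X j + of_int (\<tau> (V (Suc j))))))"
  using B l sep N
proof (induction l arbitrary: p)
  case Nil
  have "cmod (ft M (X p)) \<le> (\<Prod>j\<in>{p..<N}. cmod (cmask q (X j + of_int (\<tau> (V (Suc j))))))"
    by (rule zero_run(2)) (use Nil in auto)
  then show ?case using \<kappa>(3)[OF X_rad, of p] by simp
next
  case (Cons n l)
  let ?f = "\<lambda>j. cmod (cmask q (X j + of_int (\<tau> (V (Suc j)))))"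
  let ?g = "if n \<in> B then n - p - 1 else 0"
  have pn: "p < n" "n \<le> N" using Cons.prems by auto
  \<comment> \<open>The step into level n is taken at level n' = n - 1, after n' - p divisions by b;
    this exponent is the summand n - p - 1 of \<open>gaps\<close>.\<close>
  then obtain n' where n': "n = Suc n'" "p \<le> n'" by (cases n) auto
  have mem: "j \<in> set (n # l) \<longleftrightarrow> p < j \<and> \<tau> (V j) \<noteq> 0" for j using Cons.prems(3) by auto
  have gt: "n < j" if "j \<in> set l" for j using that Cons.prems(2) by auto
  have zero: "\<tau> (V j) = 0" if "p < j" "j \<le> n'" for j
  proof (rule ccontr)
    assume "\<tau> (V j) \<noteq> 0"
    then have "j \<in> set (n # l)" using that by (subst mem) simp
    then show False using gt[of j] that n' by auto
  qed
  have run: "X n' = X p / real b ^ (n' - p)" "cmod (ft M (X p)) \<le> (\<Prod>j\<in>{p..<n'}. ?f j)"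
    by (rule zero_run; use n' zero in simp)+
  have b1: "1 \<le> real b ^ k" for k using b_ge_4 by simp
  have last: "\<kappa> * sep / real b ^ ?g \<le> ?f n'"
  proof (cases "n \<in> B")
    case True
    have "\<kappa> * sep / real b ^ ?g \<le> \<kappa> * \<bar>X p\<bar> / real b ^ (n' - p)"
      using True \<kappa> Cons.prems(4) n' by (auto intro!: divide_right_mono mult_left_mono)
    also have "\<dots> = \<kappa> * \<bar>X n'\<bar>" by (simp add: run)
    also have "\<dots> \<le> ?f n'" by (rule \<kappa>(4)[OF X_rad])
    finally show ?thesis .
  next
    \<comment> \<open>Periodicity removes a value divisible by q from the mask, which is then at
      least |ft|, however close to 0 the position is.\<close>
    case False
    have "\<kappa> * sep / real b ^ ?g \<le> \<kappa>" using False \<kappa> sep_le_1 sep_pos by (simp add: mult_left_le)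
    also have "\<dots> \<le> cmod (cmask q (X n'))"
      by (rule order_trans[OF \<kappa>(3)[OF X_rad] norm_ft_le_cmask])
    also have "\<dots> = ?f n'"
      using Cons.prems(1)[of n] False n' by (simp add: cmask_periodic)
    finally show ?thesis .
  qed
  have rest: "\<kappa> * (\<kappa>\<^sup>2 * sep) ^ length l / real b ^ gaps B n l \<le> (\<Prod>j\<in>{n..<N}. ?f j)"
  proof (rule Cons.IH)
    show "set l = {j. n < j \<and> \<tau> (V j) \<noteq> 0}"
    proof (intro equalityI subsetI CollectI conjI)
      fix j assume "j \<in> {j. n < j \<and> \<tau> (V j) \<noteq> 0}"
      then have "n < j" "j \<in> set (n # l)" using pn mem[of j] by auto
      then show "j \<in> set l" by simp
    qed (use gt mem in auto)
    have "\<tau> (V n) \<noteq> 0" using mem[of n] by simp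
    then show "sep \<le> \<bar>X n\<bar>" unfolding n' X_Suc by (intro step_sep X_rad)
  qed (use Cons.prems pn in auto)
  have "{p..<N} = {p..<n'} \<union> insert n' {n..<N}" using n' pn by auto
  then have "(\<Prod>j\<in>{p..<N}. ?f j) = (\<Prod>j\<in>{p..<n'}. ?f j) * (?f n' * (\<Prod>j\<in>{n..<N}. ?f j))"
    using n' by (simp add: prod.union_disjoint)
  also have "\<dots> \<ge> \<kappa> * ((\<kappa> * sep / real b ^ ?g) * (\<kappa> * (\<kappa>\<^sup>2 * sep) ^ length l / real b ^ gaps B n l))"
    using \<kappa> sep_pos order_trans[OF \<kappa>(3)[OF X_rad] run(2)] last rest
    by (intro mult_mono mult_nonneg_nonneg divide_nonneg_nonneg) (auto intro: prod_nonneg)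
  finally show ?case
    by (simp add: power_add power2_eq_square mult_ac)
qed

end

section \<open>Full mass from bounded level differences\<close>

context cantor_tree
begin

text \<open>Needed twice: for the disjointness of the leaves below different children and for the
  orthogonality of the exponentials.\<close>

lemma tree_residue_inj:
  assumes "word w" "i < q" "j < q" "int q dvd \<tau> (w @ [i]) - \<tau> (w @ [j])"
  shows "i = j"
proof -
  have "int q dvd (\<tau> (w @ [i]) - \<tau> (w @ [j])) - (\<tau> (w @ [i]) - int i) + (\<tau> (w @ [j]) - int j)"
    by (rule dvd_add[OF dvd_diff[OF assms(4) tree_residue[OF assms(1,2)]] tree_residue[OF assms(1,3)]])
  then have "int q dvd int i - int j" by simp
  moreover have "\<bar>int i - int j\<bar> < int q" using assms by linarith
  ultimately show ?thesis
    using dvd_imp_le_int[of "int i - int j" "int q"] by auto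
qed

text \<open>From distance at least \<open>sep\<close> the walk can follow a word \<open>w'\<close>
  of small level difference to a leaf. The number of non-zero values and the total gap are both at
  most d, so the cost depends on d only; the square turns masks into weights.\<close>

lemma mass_defect_sep:
  assumes \<kappa>: "0 < \<kappa>" "\<kappa> \<le> 1" "\<And>x. \<bar>x\<bar> \<le> rad \<Longrightarrow> \<kappa> \<le> cmod (ft M x)"
      "\<And>x t. \<bar>x\<bar> \<le> rad \<Longrightarrow> \<kappa> * \<bar>x\<bar> \<le> cmod (cmask q (x + of_int t))"
    and m: "\<And>v y. word v \<Longrightarrow> \<bar>y\<bar> \<le> rad \<Longrightarrow> m \<le> mass v y"
    and w: "word w" and d: "level_diff_inf q \<tau> w \<le> enat d"
    and x: "sep \<le> \<bar>x\<bar>" "\<bar>x\<bar> \<le> rad"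
  shows "1 - mass w x \<le> (1 - m) * (1 - (\<kappa> * (\<kappa>\<^sup>2 * sep) ^ d / real b ^ d)\<^sup>2)"
proof -
  \<comment> \<open>There is no room between d and d + 1 in \<open>enat\<close>: as d + 1 is not a
    lower bound, some \<open>w'\<close> has level difference at most d itself.\<close>
  have "\<not> enat (Suc d) \<le> level_diff_inf q \<tau> w"
  proof
    assume "enat (Suc d) \<le> level_diff_inf q \<tau> w"
    from order_trans[OF this d] show False by simp
  qed
  then obtain w' where w': "w' \<in> words q" "level_diff q \<tau> w w' \<le> enat d"
    unfolding level_diff_inf_def le_INF_iff by (auto simp: Suc_ile_eq not_less)
  define A where "A = level_A \<tau> w w'"
  define B where "B = level_B q \<tau> w w'"
  define l where "l = sorted_list_of_set A"
  have A: "finite A" and d': "card A + gaps B 0 l \<le> d"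
    using level_diff_leD[OF w'(2)] by (simp_all add: A_def B_def l_def)
  define V where "V n = w @ pref w' n" for n
  define s where "s n = (if n < length w' then w' ! n else 0)" for n
  define X where "X = rec_nat x (\<lambda>n y. step (V (Suc n)) y)"
  interpret cantor_path q b M \<tau> V s X
  proof unfold_locales
    show "s n < q" for n
      using w'(1) q_pos nth_mem[of n w'] by (auto simp: s_def words_def simp del: nth_mem)
  qed (use w x in \<open>auto simp: V_def X_def s_def pref_Suc\<close>)
  have VX0: "V 0 = w" "X 0 = x" by (simp_all add: V_def X_def)
  have memA: "n \<in> A \<longleftrightarrow> 0 < n \<and> \<tau> (V n) \<noteq> 0" for n
    by (auto simp: A_def level_A_def V_def)
  \<comment> \<open>Beyond \<open>N\<close> the word \<open>w'\<close> is used up, so that the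
    branch continues with padding zeros, and no non-zero value remains; together this gives
    \<open>zero_tail\<close>.\<close>
  define N where "N = Max (insert 0 (insert (length w') A))"
  have NA: "n \<le> N" if "n \<in> A" for n
    unfolding N_def using A that by (intro Max_ge) auto
  have Nw: "length w' \<le> N"
    unfolding N_def using A by (intro Max_ge) auto
  have zero: "\<tau> (V n) = 0" if "N < n" for n
    using memA[of n] NA[of n] that by auto
  have "1 - mass (V 0) (X 0) \<le> (1 - m) * (1 - (\<kappa> * (\<kappa>\<^sup>2 * sep) ^ d / real b ^ d)\<^sup>2)"
  proof (rule mass_defect_leaf)
    fix n assume n: "N \<le> n"
    have "V n @ replicate k 0 = V (n + k)" for k
      unfolding V_def using n Nw by (simp add: pref_add)
    then show "zero_tail (V n)"
      unfolding zero_tail_def using n by (auto intro!: zero)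
    have len: "length l \<le> d" "gaps B 0 l \<le> d" using d' by (simp_all add: l_def)
    have b0: "1 \<le> real b" using b_ge_4 by simp
    have "\<kappa>\<^sup>2 * sep \<le> 1 * 1"
      using \<kappa> sep_pos sep_le_1 by (intro mult_mono power_le_one) auto
    then have "\<kappa> * (\<kappa>\<^sup>2 * sep) ^ d / real b ^ d \<le> \<kappa> * (\<kappa>\<^sup>2 * sep) ^ length l / real b ^ gaps B 0 l"
      using \<kappa> sep_pos len b0
      by (intro frac_le mult_left_mono power_decreasing power_increasing) auto
    also have "\<dots> \<le> (\<Prod>j\<in>{0..<n}. cmod (cmask q (X j + of_int (\<tau> (V (Suc j))))))"
    proof (rule prod_blocks[OF \<kappa>])
      show "int q dvd \<tau> (V j)" if "j \<in> set l" "j \<notin> B" for j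
        using that A by (auto simp: l_def B_def level_B_def V_def A_def level_A_def)
      show "sorted_wrt (<) (0 # l)"
        unfolding l_def using A by (auto simp: memA)
      show "set l = {n. 0 < n \<and> \<tau> (V n) \<noteq> 0}"
        using A by (auto simp: l_def memA)
      show "sep \<le> \<bar>X 0\<bar>" using x VX0 by simp
      show "j \<le> n" if "j \<in> set l" for j
        using that A NA[of j] n by (simp add: l_def)
    qed simp_all
    finally have "(\<kappa> * (\<kappa>\<^sup>2 * sep) ^ d / real b ^ d)\<^sup>2 \<le>
        (\<Prod>j\<in>{0..<n}. cmod (cmask q (X j + of_int (\<tau> (V (Suc j))))))\<^sup>2"
      using \<kappa> sep_pos by (intro power_mono) auto
    then show "(\<kappa> * (\<kappa>\<^sup>2 * sep) ^ d / real b ^ d)\<^sup>2 \<le> (\<Prod>j<n. weight (V (Suc j)) (X j))"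
      by (simp add: weight_def prod_power_distrib lessThan_atLeast0)
  qed (rule m zero; assumption)+
  then show ?thesis by (simp add: VX0)
qed

text \<open>The branch of zeros is safe from any position: its values are divisible by q, so even
  the first non-zero one is reached with a mask bounded below. It moves the walk to distance at
  least \<open>sep\<close>, where the hypothesis on c applies; the node is then non-empty, which
  matters at the root because level differences are bounded for non-empty words only. If no non-zero
  value occurs, the branch itself ends in a leaf.\<close>

lemma mass_defect:
  assumes \<kappa>: "0 < \<kappa>" "\<kappa> \<le> 1" "\<And>x. \<bar>x\<bar> \<le> rad \<Longrightarrow> \<kappa> \<le> cmod (ft M x)"
    and m: "\<And>v y. word v \<Longrightarrow> \<bar>y\<bar> \<le> rad \<Longrightarrow> m \<le> mass v y"
    and c: "0 \<le> c" "c \<le> 1"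
      "\<And>v y. word v \<Longrightarrow> v \<noteq> [] \<Longrightarrow> sep \<le> \<bar>y\<bar> \<Longrightarrow> \<bar>y\<bar> \<le> rad \<Longrightarrow> 1 - mass v y \<le> (1 - m) * (1 - c)"
    and w: "word w" and x: "\<bar>x\<bar> \<le> rad"
  shows "1 - mass w x \<le> (1 - m) * (1 - \<kappa> ^ 4 * c)"
proof -
  define V where "V n = w @ replicate n 0" for n
  define X where "X = rec_nat x (\<lambda>n y. step (V (Suc n)) y)"
  interpret cantor_path q b M \<tau> V "\<lambda>_. 0" X
    by unfold_locales
       (use w x q_pos in \<open>auto simp: V_def X_def replicate_append_same\<close>)
  have VX0: "V 0 = w" "X 0 = x" by (simp_all add: V_def X_def)
  have m1: "m \<le> 1"
    using m[OF w x] mass_le_1[OF w] by (rule order_trans)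
  have run: "\<kappa>\<^sup>2 \<le> (\<Prod>j<n. weight (V (Suc j)) (X j))"
    if "\<And>k. 0 < k \<Longrightarrow> k \<le> n \<Longrightarrow> \<tau> (V k) = 0" for n
  proof -
    have "\<kappa> \<le> cmod (ft M (X 0))" by (rule \<kappa>(3)[OF X_rad])
    also have "\<dots> \<le> (\<Prod>j\<in>{0..<n}. cmod (cmask q (X j + of_int (\<tau> (V (Suc j))))))"
      using that by (intro zero_run(2)) auto
    finally have "\<kappa>\<^sup>2 \<le> (\<Prod>j\<in>{0..<n}. cmod (cmask q (X j + of_int (\<tau> (V (Suc j))))))\<^sup>2"
      using \<kappa> by (intro power_mono) auto
    then show ?thesis by (simp add: weight_def prod_power_distrib lessThan_atLeast0)
  qed
  show ?thesis
  proof (cases "zero_tail w")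
    case True
    then have zero: "\<tau> (V k) = 0" if "0 < k" for k
      using that by (auto simp: V_def zero_tail_def)
    have "1 - mass (V 0) (X 0) \<le> (1 - m) * (1 - \<kappa>\<^sup>2)"
    proof (rule mass_defect_leaf[where N = 0])
      show "zero_tail (V n)" for n
        using zero[of "n + _"] by (auto simp: zero_tail_def V_def replicate_add)
      show "\<kappa>\<^sup>2 \<le> (\<Prod>j<n. weight (V (Suc j)) (X j))" for n
        by (rule run) (rule zero)
    qed (rule m zero; assumption)+
    also have "\<dots> \<le> (1 - m) * (1 - \<kappa> ^ 4 * c)"
    proof (intro mult_left_mono diff_left_mono)
      have "\<kappa> ^ 4 * c \<le> \<kappa>\<^sup>2 * 1"
        using \<kappa> c by (intro mult_mono power_decreasing) auto
      then show "\<kappa> ^ 4 * c \<le> \<kappa>\<^sup>2" by simp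
    qed (use m1 in simp)
    finally show ?thesis by (simp add: VX0)
  next
    case False
    then have ex: "\<exists>k. 0 < k \<and> \<tau> (V k) \<noteq> 0"
      by (auto simp: zero_tail_def V_def Suc_le_eq)
    define k where "k = (LEAST k. 0 < k \<and> \<tau> (V k) \<noteq> 0)"
    have k: "0 < k" "\<tau> (V k) \<noteq> 0"
      using LeastI_ex[OF ex] by (simp_all add: k_def)
    have zero: "\<tau> (V j) = 0" if "0 < j" "j < k" for j
      using not_less_Least[of j "\<lambda>k. 0 < k \<and> \<tau> (V k) \<noteq> 0"] that by (auto simp: k_def)
    obtain n where n: "k = Suc n" using k by (cases k) auto
    define P where "P = (\<Prod>j<k. weight (V (Suc j)) (X j))"
    have P: "0 \<le> P" "P \<le> 1" unfolding P_def
      by (intro prod_nonneg prod_le_1 ballI conjI weight_nonneg weight_le_1)+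
    have Vk: "V k = V n @ [0]" unfolding n by (rule V_Suc)
    have "int q dvd \<tau> (V k)"
      using tree_residue[OF word_V[of n] q_pos] by (simp add: Vk)
    then have "weight (V k) (X n) = (cmod (cmask q (X n)))\<^sup>2"
      by (simp add: weight_def cmask_periodic)
    moreover have "\<kappa> \<le> cmod (cmask q (X n))"
      by (rule order_trans[OF \<kappa>(3)[OF X_rad] norm_ft_le_cmask])
    ultimately have "\<kappa>\<^sup>2 \<le> weight (V k) (X n)"
      using \<kappa> by (simp add: power_mono)
    moreover have "\<kappa>\<^sup>2 \<le> (\<Prod>j<n. weight (V (Suc j)) (X j))"
      by (rule run) (rule zero; simp add: n)
    \<comment> \<open>One factor \<kappa>^2 for the run of zeros, one for the step to the first
      non-zero value.\<close>
    ultimately have "\<kappa>\<^sup>2 * \<kappa>\<^sup>2 \<le> P"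
      unfolding P_def n prod.lessThan_Suc
      by (subst mult.commute, intro mult_mono) (simp_all add: n weight_nonneg prod_nonneg)
    then have \<kappa>P: "\<kappa> ^ 4 \<le> P" by (simp add: power_add[symmetric])
    have "sep \<le> \<bar>X k\<bar>"
      unfolding n X_Suc using k n by (intro step_sep X_rad) auto
    then have "1 - mass (V k) (X k) \<le> (1 - m) * (1 - c)"
      by (intro c word_V X_rad) (simp_all add: Vk)
    then have "P * (1 - mass (V k) (X k)) \<le> P * ((1 - m) * (1 - c))"
      by (rule mult_left_mono) (rule P)
    moreover have "1 - mass (V 0) (X 0) \<le> (1 - m) * (1 - P) + P * (1 - mass (V k) (X k))"
      unfolding P_def by (rule mass_defect_path) (rule m)
    ultimately have "1 - mass w x \<le> (1 - m) * (1 - P) + P * ((1 - m) * (1 - c))"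
      unfolding VX0 by (rule order_trans[OF _ add_left_mono, rotated])
    also have "\<dots> = (1 - m) * (1 - P * c)" by (simp add: algebra_simps)
    also have "\<dots> \<le> (1 - m) * (1 - \<kappa> ^ 4 * c)"
      using m1 c \<kappa>P by (intro mult_left_mono diff_left_mono mult_right_mono) auto
    finally show ?thesis .
  qed
qed

text \<open>A single infimum over all words and all |y| \<le> rad serves every branch that is left,
  since the children of such a pair are again such pairs. A defect bound with a factor uniformly
  below 1 forces the infimum to be 1, whether or not it is attained.\<close>

lemma mass_eq_1_rad:
  assumes bounded: "level_diff_sup q \<tau> < \<infinity>" and w: "word w" and x: "\<bar>x\<bar> \<le> rad"
  shows "mass w x = 1"
proof -
  obtain \<kappa> where \<kappa>: "0 < \<kappa>" "\<kappa> \<le> 1" "\<And>x. \<bar>x\<bar> \<le> rad \<Longrightarrow> \<kappa> \<le> cmod (ft M x)"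
      "\<And>x t. \<bar>x\<bar> \<le> rad \<Longrightarrow> \<kappa> * \<bar>x\<bar> \<le> cmod (cmask q (x + of_int t))"
    using bounds[OF rad] by blast
  obtain d where d: "level_diff_sup q \<tau> = enat d" using bounded by auto
  have dw: "level_diff_inf q \<tau> v \<le> enat d" if "word v" "v \<noteq> []" for v
    unfolding d[symmetric] level_diff_sup_def using that by (intro SUP_upper) (simp add: words_def)
  define S where "S = (\<lambda>(v, y). mass v y) ` {(v, y). word v \<and> \<bar>y\<bar> \<le> rad}"
  have "bdd_below S" unfolding S_def by (intro bdd_belowI[of _ 0]) (auto intro: mass_nonneg)
  then have m: "Inf S \<le> mass v y" if "word v" "\<bar>y\<bar> \<le> rad" for v y
    using that by (intro cInf_lower) (auto simp: S_def)
  define c where "c = (\<kappa> * (\<kappa>\<^sup>2 * sep) ^ d / real b ^ d)\<^sup>2"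
  have c0: "0 < c" using \<kappa> sep_pos b_ge_4 by (simp add: c_def)
  have "\<kappa>\<^sup>2 * sep \<le> 1 * 1"
    using \<kappa> sep_pos sep_le_1 by (intro mult_mono power_le_one) auto
  then have "\<kappa> * (\<kappa>\<^sup>2 * sep) ^ d / real b ^ d \<le> 1 * 1 / 1"
    using \<kappa> sep_pos b_ge_4 by (intro frac_le mult_mono power_le_one) auto
  then have c1: "c \<le> 1"
    unfolding c_def using \<kappa> sep_pos by (intro power_le_one) auto
  have defect: "1 - mass v y \<le> (1 - Inf S) * (1 - \<kappa> ^ 4 * c)" if "word v" "\<bar>y\<bar> \<le> rad" for v y
  proof (rule mass_defect[OF \<kappa>(1-3) m _ c1 _ that])
    show "1 - mass v y \<le> (1 - Inf S) * (1 - c)"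
      if "word v" "v \<noteq> []" "sep \<le> \<bar>y\<bar>" "\<bar>y\<bar> \<le> rad" for v y
      unfolding c_def by (rule mass_defect_sep[OF \<kappa> m that(1) dw[OF that(1,2)] that(3,4)])
  qed (use c0 in auto)
  have "1 - (1 - Inf S) * (1 - \<kappa> ^ 4 * c) \<le> Inf S"
  proof (rule cInf_greatest)
    show "S \<noteq> {}" using w x by (auto simp: S_def)
    show "1 - (1 - Inf S) * (1 - \<kappa> ^ 4 * c) \<le> z" if "z \<in> S" for z
      using that defect by (fastforce simp: S_def)
  qed
  then have "(1 - Inf S) * (\<kappa> ^ 4 * c) \<le> 0" by (simp add: algebra_simps)
  moreover have "0 < \<kappa> ^ 4 * c" using \<kappa> c0 by simp
  ultimately have "1 - Inf S \<le> 0"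
    by (meson mult_pos_pos not_le)
  then show ?thesis using m[OF w x] mass_le_1[OF w, of x] by linarith
qed

text \<open>With a the fixed point of t \<mapsto> (t + b - 2) / b, the bound for the excess of |x|
  over a shrinks by the factor b in every step. Every position thus comes within \<open>rad\<close>
  after finitely many steps, and mass 1 is passed up through \<open>mass_rec\<close>.\<close>

lemma mass_eq_1:
  assumes bounded: "level_diff_sup q \<tau> < \<infinity>" and w: "word w"
  shows "mass w x = 1"
proof -
  define a where "a = (real b - 2) / (real b - 1)"
  have b1: "0 < real b - 1" using b_ge_4 by simp
  have a: "a < rad"
    using b1 by (simp add: a_def rad_def field_simps)
  have "a * (real b - 1) = real b - 2" using b1 by (simp add: a_def)
  then have "a + (real b - 2) = a * real b" by (simp add: algebra_simps)
  then have ab: "(a + (real b - 2)) / real b = a" using b1 by simp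
  have main: "mass w x = 1" if "word w" "\<bar>x\<bar> \<le> a + (rad - a) * real b ^ n" for w x n
    using that
  proof (induction n arbitrary: w x)
    case 0
    then show ?case by (intro mass_eq_1_rad bounded) auto
  next
    case (Suc n)
    have "mass (w @ [i]) (step (w @ [i]) x) = 1" if i: "i < q" for i
    proof (rule Suc.IH)
      show wi: "word (w @ [i])" using Suc.prems i by auto
      have "\<bar>x + of_int (\<tau> (w @ [i]))\<bar> \<le> (a + (rad - a) * real b ^ Suc n) + (real b - 2)"
        using tree_abs[OF wi] Suc.prems by simp
      then have "\<bar>step (w @ [i]) x\<bar> \<le> ((a + (real b - 2)) + (rad - a) * real b ^ Suc n) / real b"
        unfolding step_def using b1 by (simp add: divide_right_mono algebra_simps)
      also have "\<dots> = a + (rad - a) * real b ^ n"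
        unfolding add_divide_distrib[of _ "(rad - a) * _"] ab using b1 by simp
      finally show "\<bar>step (w @ [i]) x\<bar> \<le> a + (rad - a) * real b ^ n" .
    qed
    then show ?case
      unfolding mass_rec[OF Suc.prems(1)] using sum_weight[OF Suc.prems(1)] by simp
  qed
  obtain n where "(\<bar>x\<bar> - a) / (rad - a) < real b ^ n"
    using real_arch_pow[of "real b" "(\<bar>x\<bar> - a) / (rad - a)"] b1 by auto
  then have "\<bar>x\<bar> \<le> a + (rad - a) * real b ^ n"
    using a by (simp add: field_simps)
  then show ?thesis by (rule main[OF w])
qed

section \<open>Leaves as frequencies: Parseval's identity and orthogonality\<close>

primrec leaves :: "nat \<Rightarrow> nat list \<Rightarrow> int set" where
  "leaves 0 w = (if zero_tail w then {0} else {})"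
| "leaves (Suc n) w = (\<Union>i<q. (\<lambda>l. \<tau> (w @ [i]) + int b * l) ` leaves n (w @ [i]))"

lemma finite_leaves: "finite (leaves n w)"
  by (induction n arbitrary: w) auto

text \<open>Because q divides b, adding b * l does not change the mask, so \<open>ft_rec\<close>
  merges a weight and |ft|^2 at the child into |ft|^2 at the parent. The leaves of different
  children differ modulo q, so no term is lost in the union.\<close>

lemma leaf_mass_eq_sum:
  "word w \<Longrightarrow> leaf_mass n w x = (\<Sum>l\<in>leaves n w. (cmod (ft M (x + of_int l)))\<^sup>2)"
proof (induction n arbitrary: w x)
  case (Suc n)
  let ?g = "\<lambda>i l. \<tau> (w @ [i]) + int b * l"
  let ?F = "\<lambda>l. (cmod (ft M (x + of_int l)))\<^sup>2"
  have b0: "b \<noteq> 0" using b_ge_4 by simp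
  have disj: "?g i ` leaves n (w @ [i]) \<inter> ?g j ` leaves n (w @ [j]) = {}"
    if "i < q" "j < q" "i \<noteq> j" for i j
  proof (rule ccontr)
    assume "?g i ` leaves n (w @ [i]) \<inter> ?g j ` leaves n (w @ [j]) \<noteq> {}"
    then obtain k l where "?g i k = ?g j l" by auto
    then have "\<tau> (w @ [i]) - \<tau> (w @ [j]) = int b * (l - k)" by (simp add: algebra_simps)
    then have "int q dvd \<tau> (w @ [i]) - \<tau> (w @ [j])"
      using qb by (metis dvd_mult2 int_dvd_int_iff)
    then show False using tree_residue_inj[OF Suc.prems] that by blast
  qed
  have reindex: "sum ?F (?g i ` leaves n (w @ [i])) = (\<Sum>l\<in>leaves n (w @ [i]). ?F (?g i l))" for i
    by (subst sum.reindex) (use b0 in \<open>auto simp: inj_on_def\<close>)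
  have "leaf_mass (Suc n) w x = (\<Sum>i<q. \<Sum>l\<in>leaves n (w @ [i]). ?F (?g i l))"
    unfolding leaf_mass.simps
  proof (intro sum.cong refl)
    fix i assume "i \<in> {..<q}"
    then have wi: "word (w @ [i])" using Suc.prems by auto
    have "weight (w @ [i]) x * (cmod (ft M (step (w @ [i]) x + of_int l)))\<^sup>2 = ?F (?g i l)" for l
    proof -
      have dvd: "int q dvd int b * l" using qb by simp
      have "x + of_int (?g i l) = (x + of_int (\<tau> (w @ [i]))) + of_int (int b * l)" by simp
      then have "cmask q (x + of_int (?g i l)) = cmask q (x + of_int (\<tau> (w @ [i])))"
        using cmask_periodic[OF dvd] by (simp only:)
      moreover have "(x + of_int (?g i l)) / real b = step (w @ [i]) x + of_int l"
        using b0 by (simp add: step_def field_simps)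
      ultimately show ?thesis
        by (subst (2) ft_rec) (simp add: weight_def norm_mult power_mult_distrib)
    qed
    then show "weight (w @ [i]) x * leaf_mass n (w @ [i]) (step (w @ [i]) x) =
        (\<Sum>l\<in>leaves n (w @ [i]). ?F (?g i l))"
      by (simp add: Suc.IH[OF wi] sum_distrib_left)
  qed
  also have "\<dots> = (\<Sum>i<q. sum ?F (?g i ` leaves n (w @ [i])))"
    by (simp only: reindex)
  also have "\<dots> = sum ?F (\<Union>i<q. ?g i ` leaves n (w @ [i]))"
    by (rule sum.UNION_disjoint[symmetric]) (use disj finite_leaves in auto)
  finally show ?case by simp
qed simp

lemma mem_leavesE:
  assumes "l \<in> leaves n w"
  obtains u where "length u = n" "word u" "zero_tail (w @ u)"
    "l = (\<Sum>k<n. \<tau> (w @ take (Suc k) u) * int b ^ k)"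
  using assms
proof (induction n arbitrary: w l thesis)
  case 0
  then show ?case by (auto split: if_splits)
next
  case (Suc n)
  from Suc.prems(2) obtain i l' where i: "i < q" "l' \<in> leaves n (w @ [i])"
    "l = \<tau> (w @ [i]) + int b * l'" by auto
  obtain u where u: "length u = n" "word u" "zero_tail ((w @ [i]) @ u)"
    "l' = (\<Sum>k<n. \<tau> ((w @ [i]) @ take (Suc k) u) * int b ^ k)"
    using Suc.IH[OF _ i(2)] by blast
  show ?case
  proof (rule Suc.prems(1)[of "i # u"])
    show "l = (\<Sum>k<Suc n. \<tau> (w @ take (Suc k) (i # u)) * int b ^ k)"
      unfolding i(3) u(4) by (simp add: sum.lessThan_Suc_shift sum_distrib_left mult_ac del: sum.lessThan_Suc)
  qed (use i u in auto)
qed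

text \<open>The depth is \<open>Suc n\<close> because \<open>words q\<close> excludes the empty
  word; the frequency 0 of the root reappears one level deeper.\<close>

lemma leaves_subset_tree_spectrum:
  assumes "l \<in> leaves (Suc n) []"
  shows "of_int l \<in> tree_spectrum q b \<tau>"
proof -
  obtain u where u: "length u = Suc n" "word u" "zero_tail u"
    "l = (\<Sum>k<Suc n. \<tau> (take (Suc k) u) * int b ^ k)"
    using mem_leavesE[OF assms] by auto
  have p: "pref u k = u @ replicate (k - Suc n) 0" if "Suc n \<le> k" for k
    using pref_add[of u "Suc n" "k - Suc n"] u(1) that by (simp add: pref_def)
  have zero: "\<tau> (pref u k) = 0" if "Suc n < k" for k
    using u(3) that by (simp add: p zero_tail_def)
  have "(\<Sum>k. of_int (\<tau> (pref u (Suc k))) * real b ^ k) =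
      (\<Sum>k<Suc n. of_int (\<tau> (pref u (Suc k))) * real b ^ k)"
    by (rule suminf_finite) (auto simp: zero)
  also have "\<dots> = of_int l"
    unfolding u(4) of_int_sum by (intro sum.cong refl) (use u(1) in \<open>auto simp: pref_def\<close>)
  finally have "of_int l = (\<Sum>k. of_int (\<tau> (pref u (Suc k))) * real b ^ k)" ..
  moreover have "u \<in> words q" using u by (auto simp: words_def)
  moreover have "\<forall>\<^sub>F m in sequentially. \<tau> (pref u m) = 0"
    unfolding eventually_sequentially using zero by (intro exI[of _ "Suc (Suc n)"]) simp
  ultimately show ?thesis unfolding tree_spectrum_def by blast
qed

text \<open>This is mass 1 at the root in position -x: reflection turns |ft (-x + l)| into |ft (x -
  l)|, the modulus of the coefficient of \<open>expo x\<close> at l.\<close>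

lemma parseval:
  assumes "level_diff_sup q \<tau> < \<infinity>" "0 < \<epsilon>"
  obtains F where "finite F" "F \<subseteq> tree_spectrum q b \<tau>"
    "1 - \<epsilon> < (\<Sum>l\<in>F. (cmod (ft M (x - l)))\<^sup>2)"
proof -
  have "(\<lambda>n. leaf_mass (Suc n) [] (- x)) \<longlonglongrightarrow> 1"
    using LIMSEQ_Suc[OF leaf_mass_tendsto[of "[]" "- x"]] mass_eq_1[OF assms(1), of "[]" "- x"] by simp
  then have "\<forall>\<^sub>F n in sequentially. 1 - \<epsilon> < leaf_mass (Suc n) [] (- x)"
    by (rule order_tendstoD) (use assms(2) in simp)
  then obtain n where n: "1 - \<epsilon> < leaf_mass (Suc n) [] (- x)"
    by (auto simp: eventually_sequentially)
  show thesis
  proof (rule that[of "of_int ` leaves (Suc n) []"])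
    have "leaf_mass (Suc n) [] (- x) = (\<Sum>l\<in>leaves (Suc n) []. (cmod (ft M (- x + of_int l)))\<^sup>2)"
      by (rule leaf_mass_eq_sum) simp
    also have "\<dots> = (\<Sum>l\<in>leaves (Suc n) []. (cmod (ft M (x - of_int l)))\<^sup>2)"
      using norm_ft_minus[of M "x - of_int _"] by (intro sum.cong refl) simp
    also have "\<dots> = (\<Sum>l\<in>of_int ` leaves (Suc n) []. (cmod (ft M (x - l)))\<^sup>2)"
      by (subst sum.reindex) (auto simp: inj_on_def)
    finally show "1 - \<epsilon> < (\<Sum>l\<in>of_int ` leaves (Suc n) []. (cmod (ft M (x - l)))\<^sup>2)"
      using n by simp
    show "of_int ` leaves (Suc n) [] \<subseteq> tree_spectrum q b \<tau>"
      using leaves_subset_tree_spectrum by blast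
  qed (simp add: finite_leaves del: leaves.simps)
qed

text \<open>The lowest level at which two words branch determines the \<open>b\<close>-adic valuation of the difference.\<close>

lemma tree_spectrum_diff:
  assumes "l \<in> tree_spectrum q b \<tau>" "l' \<in> tree_spectrum q b \<tau>" "l \<noteq> l'"
  obtains k n where "\<not> int q dvd k" "l - l' = of_int k * real b ^ n"
proof -
  obtain w where w: "w \<in> words q" "\<forall>\<^sub>F m in sequentially. \<tau> (pref w m) = 0"
    "l = (\<Sum>n. of_int (\<tau> (pref w (Suc n))) * real b ^ n)"
    using assms(1) unfolding tree_spectrum_def by blast
  obtain w' where w': "w' \<in> words q" "\<forall>\<^sub>F m in sequentially. \<tau> (pref w' m) = 0"
    "l' = (\<Sum>n. of_int (\<tau> (pref w' (Suc n))) * real b ^ n)"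
    using assms(2) unfolding tree_spectrum_def by blast
  obtain N where N: "\<And>m. N \<le> m \<Longrightarrow> \<tau> (pref w m) = 0 \<and> \<tau> (pref w' m) = 0"
    using eventually_conj[OF w(2) w'(2)] by (auto simp: eventually_sequentially)
  define t where "t n = \<tau> (pref w (Suc n)) - \<tau> (pref w' (Suc n))" for n
  have fin: "(\<Sum>n. of_int (\<tau> (pref v (Suc n))) * real b ^ n) =
      (\<Sum>n<N. of_int (\<tau> (pref v (Suc n))) * real b ^ n)" if "v \<in> {w, w'}" for v
    by (rule suminf_finite) (use N that in auto)
  have diff: "l - l' = (\<Sum>n<N. of_int (t n) * real b ^ n)"
    unfolding w(3) w'(3) using fin by (simp add: t_def left_diff_distrib sum_subtractf)
  have "\<exists>n. pref w n \<noteq> pref w' n"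
  proof (rule ccontr)
    assume "\<not> ?thesis"
    then have "pref w = pref w'" by auto
    then show False using assms(3) w(3) w'(3) by simp
  qed
  then have ex: "\<exists>n. pref w (Suc n) \<noteq> pref w' (Suc n)"
  proof
    fix n assume "pref w n \<noteq> pref w' n"
    then show ?thesis by (cases n) auto
  qed
  define n where "n = (LEAST n. pref w (Suc n) \<noteq> pref w' (Suc n))"
  have n: "pref w (Suc n) \<noteq> pref w' (Suc n)"
    unfolding n_def by (rule LeastI_ex[OF ex])
  have same: "pref w (Suc j) = pref w' (Suc j)" if "j < n" for j
    using not_less_Least[of j "\<lambda>n. pref w (Suc n) \<noteq> pref w' (Suc n)"] that by (auto simp: n_def)
  have samen: "pref w n = pref w' n"
    using same[of "n - 1"] by (cases n) auto
  obtain i j where ij: "pref w (Suc n) = pref w n @ [i]" "pref w' (Suc n) = pref w n @ [j]"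
    using pref_Suc[of w n] pref_Suc[of w' n] samen by auto
  have words: "word (pref w k)" "word (pref w' k)" for k
    using w(1) w'(1) q_pos by (simp_all add: words_def set_pref)
  have lt: "i < q" "j < q" and neq: "i \<noteq> j"
    using words[of "Suc n"] n ij by auto
  have tn: "\<not> int q dvd t n"
  proof
    assume "int q dvd t n"
    then show False
      using tree_residue_inj[OF words(1) lt] neq by (simp add: t_def ij)
  qed
  have nN: "n < N"
  proof (rule ccontr)
    assume "\<not> n < N"
    then have "t n = 0" using N[of "Suc n"] by (simp add: t_def)
    then show False using tn by simp
  qed
  define k where "k = (\<Sum>j\<in>{n..<N}. t j * int b ^ (j - n))"
  have "{..<N} = {..<n} \<union> {n..<N}" using nN by auto
  then have "(\<Sum>j<N. t j * int b ^ j) = (\<Sum>j<n. t j * int b ^ j) + (\<Sum>j\<in>{n..<N}. t j * int b ^ j)"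
    by (simp add: sum.union_disjoint ivl_disj_int)
  also have "(\<Sum>j<n. t j * int b ^ j) = 0"
    by (rule sum.neutral) (simp add: t_def same)
  also have "(\<Sum>j\<in>{n..<N}. t j * int b ^ j) = k * int b ^ n"
    unfolding k_def sum_distrib_right
    by (intro sum.cong refl) (simp add: power_add[symmetric] mult.assoc)
  finally have "of_int (\<Sum>j<N. t j * int b ^ j) = real_of_int (k * int b ^ n)" by simp
  then have "l - l' = of_int k * real b ^ n" by (simp add: diff)
  moreover have "\<not> int q dvd k"
  proof
    assume "int q dvd k"
    have "k = t n + (\<Sum>j\<in>{Suc n..<N}. t j * int b ^ (j - n))"
      unfolding k_def using nN by (simp add: sum.atLeast_Suc_lessThan)
    moreover have "int q dvd (\<Sum>j\<in>{Suc n..<N}. t j * int b ^ (j - n))"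
    proof (intro dvd_sum dvd_mult)
      fix j assume "j \<in> {Suc n..<N}"
      then have "int b dvd int b ^ (j - n)" by (intro dvd_power) auto
      then show "int q dvd int b ^ (j - n)" using qb by (meson dvd_trans int_dvd_int_iff)
    qed
    ultimately have "int q dvd t n" using \<open>int q dvd k\<close> by (simp add: dvd_add_left_iff)
    then show False using tn by simp
  qed
  ultimately show thesis using that by blast
qed

lemma tree_spectrum_orthogonal:
  assumes "l \<in> tree_spectrum q b \<tau>" "l' \<in> tree_spectrum q b \<tau>" "l \<noteq> l'"
  shows "ft M (l - l') = 0"
  using tree_spectrum_diff[OF assms] ft_eq_0 by metis

end

section \<open>Density in the space of square-integrable functions\<close>

text \<open>An inductive closure instead of explicit sums, so that approximation passes through it
  by rule induction; \<open>trig_spanE\<close> recovers the finite sum. For \<open>UNIV\<close>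
  these are the trigonometric polynomials with arbitrary real frequencies.\<close>

inductive_set trig_span :: "real set \<Rightarrow> (real \<Rightarrow> complex) set" for L where
  expo: "l \<in> L \<Longrightarrow> expo l \<in> trig_span L"
| zero: "(\<lambda>_. 0) \<in> trig_span L"
| add: "f \<in> trig_span L \<Longrightarrow> g \<in> trig_span L \<Longrightarrow> (\<lambda>x. f x + g x) \<in> trig_span L"
| scale: "f \<in> trig_span L \<Longrightarrow> (\<lambda>x. c * f x) \<in> trig_span L"

lemma trig_span_sum:
  "finite F \<Longrightarrow> F \<subseteq> L \<Longrightarrow> (\<lambda>x. \<Sum>l\<in>F. c l * expo l x) \<in> trig_span L"
proof (induction F rule: finite_induct)
  case (insert l F)
  then show ?case
    using trig_span.add[OF trig_span.scale[OF trig_span.expo[of l L], of "c l"]] by simp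
qed (simp add: trig_span.zero)

lemma trig_spanE:
  assumes "g \<in> trig_span L"
  obtains F c where "finite F" "F \<subseteq> L" "g = (\<lambda>x. \<Sum>l\<in>F. c l * expo l x)"
  using assms
proof (induction arbitrary: thesis)
  case (expo l)
  show ?case by (rule expo(2)[of "{l}" "\<lambda>_. 1"]) (use expo in auto)
next
  case zero
  show ?case by (rule zero[of "{}"]) auto
next
  case (add f g)
  obtain F c where F: "finite F" "F \<subseteq> L" "f = (\<lambda>x. \<Sum>l\<in>F. c l * expo l x)"
    using add.IH(1) by blast
  obtain G d where G: "finite G" "G \<subseteq> L" "g = (\<lambda>x. \<Sum>l\<in>G. d l * expo l x)"
    using add.IH(2) by blast
  have ext: "(\<Sum>l\<in>H. e l * expo l x) = (\<Sum>l\<in>F \<union> G. (if l \<in> H then e l else 0) * expo l x)"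
    if "H \<subseteq> F \<union> G" for H e x
    using F(1) G(1) that by (intro sum.mono_neutral_cong_left) auto
  show ?case
  proof (rule add.prems)
    show "(\<lambda>x. f x + g x) =
        (\<lambda>x. \<Sum>l\<in>F \<union> G. ((if l \<in> F then c l else 0) + (if l \<in> G then d l else 0)) * expo l x)"
      unfolding F(3) G(3) distrib_right sum.distrib
      by (subst (1) ext[of F c], simp, subst (1) ext[of G d], simp, rule refl)
  qed (use F G in auto)
next
  case (scale f c)
  obtain F d where F: "finite F" "F \<subseteq> L" "f = (\<lambda>x. \<Sum>l\<in>F. d l * expo l x)"
    using scale.IH by blast
  show ?case
    by (rule scale.prems[of F "\<lambda>l. c * d l"]) (use F in \<open>auto simp: sum_distrib_left mult_ac\<close>)
qed

lemma continuous_on_trig_span: "g \<in> trig_span L \<Longrightarrow> continuous_on S g"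
  by (induction rule: trig_span.induct) (auto intro!: continuous_intros continuous_on_expo)

lemma measurable_trig_span: "g \<in> trig_span L \<Longrightarrow> g \<in> borel_measurable borel"
  by (intro borel_measurable_continuous_onI continuous_on_trig_span)

lemma bounded_trig_span: "g \<in> trig_span L \<Longrightarrow> \<exists>C. \<forall>x. cmod (g x) \<le> C"
proof (induction rule: trig_span.induct)
  case (add f g)
  then obtain C D where "\<forall>x. cmod (f x) \<le> C" "\<forall>x. cmod (g x) \<le> D" by blast
  then have "cmod (f x + g x) \<le> C + D" for x
    using norm_triangle_mono by blast
  then show ?case by blast
next
  case (scale f c)
  then obtain C where "\<forall>x. cmod (f x) \<le> C" by blast
  then have "cmod (c * f x) \<le> cmod c * C" for x
    by (simp add: norm_mult mult_left_mono)
  then show ?case by blast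
qed (auto intro: exI[of _ 1] exI[of _ 0])

lemma trig_span_mult:
  assumes "f \<in> trig_span UNIV" "g \<in> trig_span UNIV"
  shows "(\<lambda>x. f x * g x) \<in> trig_span UNIV"
proof -
  have *: "(\<lambda>x. expo l x * g x) \<in> trig_span UNIV" for l
    using assms(2)
  proof (induction rule: trig_span.induct)
    case (expo k)
    have "(\<lambda>x. expo l x * expo k x) = expo (l + k)" by (rule ext) (simp add: expo_add)
    then show ?case by (simp add: trig_span.expo)
  next
    case zero
    show ?case by (simp add: trig_span.zero)
  next
    case (add f g)
    then show ?case unfolding distrib_left by (intro trig_span.add)
  next
    case (scale f c)
    then show ?case unfolding mult.left_commute[of _ c] by (intro trig_span.scale)
  qed
  from assms(1) show ?thesis
  proof (induction rule: trig_span.induct)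
    case zero
    show ?case by (simp add: trig_span.zero)
  next
    case (add f g)
    then show ?case unfolding distrib_right by (intro trig_span.add)
  next
    case (scale f c)
    then show ?case unfolding mult.assoc by (intro trig_span.scale)
  qed (rule *)
qed

text \<open>Stone-Weierstrass, applied to the real functions whose complex copies lie in the span:
  they form a real algebra, and sines separate points.\<close>

lemma trig_span_dense_real:
  fixes \<phi> :: "real \<Rightarrow> real"
  assumes \<phi>: "continuous_on {-K..K} \<phi>" and e: "0 < e"
  obtains g where "g \<in> trig_span UNIV" "\<And>x. \<bar>x\<bar> \<le> K \<Longrightarrow> cmod (of_real (\<phi> x) - g x) < e"
proof -
  define P where "P f \<longleftrightarrow> (\<lambda>x. complex_of_real (f x)) \<in> trig_span UNIV" for f
  have "\<exists>g. P g \<and> (\<forall>x\<in>{-K..K}. \<bar>\<phi> x - g x\<bar> < e)"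
  proof (rule Stone_Weierstrass_HOL)
    show "compact {-K..K}" by simp
    show "P (\<lambda>x. c)" for c
      unfolding P_def using trig_span.scale[OF trig_span.expo[of 0], of UNIV "of_real c"] by simp
    show "continuous_on {-K..K} f" if "P f" for f
      using continuous_on_Re[OF continuous_on_trig_span[OF that[unfolded P_def], of "{-K..K}"]] by simp
    show "P (\<lambda>x. f x + g x)" if "P f \<and> P g" for f g
      using that trig_span.add[of "\<lambda>x. of_real (f x)" UNIV "\<lambda>x. of_real (g x)"] by (simp add: P_def)
    show "P (\<lambda>x. f x * g x)" if "P f \<and> P g" for f g
      using that trig_span_mult[of "\<lambda>x. of_real (f x)" "\<lambda>x. of_real (g x)"] by (simp add: P_def)
    show "\<exists>f. P f \<and> f x \<noteq> f y" if xy: "x \<in> {-K..K} \<and> y \<in> {-K..K} \<and> x \<noteq> y" for x y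
    proof (intro exI conjI)
      \<comment> \<open>The frequency t is so low that 2 * pi * t * z stays in [-pi / 2, pi / 2] for
        |z| \<le> s, where the sine is injective.\<close>
      define s where "s = \<bar>x\<bar> + \<bar>y\<bar>"
      define t where "t = 1 / (4 * s)"
      have pos: "0 < s" using xy by (auto simp: s_def)
      have eq: "complex_of_real (sin (2 * pi * t * z)) =
          (- (\<i> / 2)) * expo (- t) z + (\<i> / 2) * expo t z" for z
        by (simp add: expo_conv_cis complex_eq_iff)
      show "P (\<lambda>z. sin (2 * pi * t * z))"
        unfolding P_def eq by (intro trig_span.add trig_span.scale trig_span.expo UNIV_I)
      have range: "\<bar>2 * pi * t * z\<bar> \<le> pi / 2" if "\<bar>z\<bar> \<le> s" for z
      proof -
        have "\<bar>2 * pi * t * z\<bar> = (2 * pi * t) * \<bar>z\<bar>" using pos by (simp add: abs_mult t_def)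
        also have "\<dots> \<le> (2 * pi * t) * s"
          using pos that by (intro mult_left_mono) (auto simp: t_def)
        also have "\<dots> = pi / 2" using pos by (simp add: t_def)
        finally show ?thesis .
      qed
      have "2 * pi * t * x \<noteq> 2 * pi * t * y" using xy pos by (simp add: t_def)
      moreover have "2 * pi * t * x = 2 * pi * t * y" if "sin (2 * pi * t * x) = sin (2 * pi * t * y)"
      proof (rule sin_inj_pi[OF _ _ _ _ that])
        have "\<bar>2 * pi * t * x\<bar> \<le> pi / 2" "\<bar>2 * pi * t * y\<bar> \<le> pi / 2"
          by (rule range; simp add: s_def)+
        then show "- (pi / 2) \<le> 2 * pi * t * x" "2 * pi * t * x \<le> pi / 2"
          "- (pi / 2) \<le> 2 * pi * t * y" "2 * pi * t * y \<le> pi / 2"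
          unfolding abs_le_iff by linarith+
      qed
      ultimately show "sin (2 * pi * t * x) \<noteq> sin (2 * pi * t * y)" by blast
    qed
  qed (rule \<phi> e)+
  then obtain g where g: "P g" "\<And>x. x \<in> {-K..K} \<Longrightarrow> \<bar>\<phi> x - g x\<bar> < e" by blast
  show thesis
  proof (rule that)
    show "(\<lambda>x. complex_of_real (g x)) \<in> trig_span UNIV" using g(1) by (simp add: P_def)
    show "cmod (of_real (\<phi> x) - of_real (g x)) < e" if "\<bar>x\<bar> \<le> K" for x
    proof -
      have "\<bar>\<phi> x - g x\<bar> < e" by (rule g(2)) (use that in auto)
      then show ?thesis by (simp only: of_real_diff[symmetric] norm_of_real)
    qed
  qed
qed

text \<open>Takes the place of the triangle inequality, so that squared distances can be used
  throughout; the factor 2 is the reason for the \<epsilon> / 4 in the closure arguments.\<close>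

lemma norm_add_power2_le: "(cmod (a + b))\<^sup>2 \<le> 2 * (cmod a)\<^sup>2 + 2 * (cmod b)\<^sup>2"
proof -
  have "(cmod (a + b))\<^sup>2 \<le> (cmod a + cmod b)\<^sup>2"
    by (intro power_mono norm_triangle_ineq) simp
  then show ?thesis using sum_squares_bound[of "cmod a" "cmod b"] by (simp add: power2_sum)
qed

section \<open>The closed linear span of the exponentials\<close>

context real_distribution
begin

lemma l2_fun_bounded:
  assumes "f \<in> borel_measurable borel" "\<And>x. cmod (f x) \<le> C"
  shows "l2_fun M f"
  unfolding l2_fun_def
proof
  note [measurable] = assms(1)
  show "f \<in> borel_measurable M" by measurable
  show "integrable M (\<lambda>x. (cmod (f x))\<^sup>2)"
    by (rule integrable_const_bound[where B = "C\<^sup>2"]) (use assms(2) in \<open>auto intro!: power_mono\<close>)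
qed

lemma l2_fun_add:
  assumes "l2_fun M f" "l2_fun M g"
  shows "l2_fun M (\<lambda>x. f x + g x)"
  unfolding l2_fun_def
proof
  have [measurable]: "f \<in> borel_measurable M" "g \<in> borel_measurable M"
    using assms by (auto simp: l2_fun_def)
  show "(\<lambda>x. f x + g x) \<in> borel_measurable M" by measurable
  show "integrable M (\<lambda>x. (cmod (f x + g x))\<^sup>2)"
  proof (rule Bochner_Integration.integrable_bound)
    show "integrable M (\<lambda>x. 2 * (cmod (f x))\<^sup>2 + 2 * (cmod (g x))\<^sup>2)"
      using assms by (auto simp: l2_fun_def)
  qed (auto intro!: AE_I2 norm_add_power2_le)
qed

lemma l2_fun_scale: "l2_fun M f \<Longrightarrow> l2_fun M (\<lambda>x. c * f x)"
  by (auto simp: l2_fun_def norm_mult power_mult_distrib)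

lemma l2_fun_diff: "l2_fun M f \<Longrightarrow> l2_fun M g \<Longrightarrow> l2_fun M (\<lambda>x. f x - g x)"
  using l2_fun_add[of f "\<lambda>x. - 1 * g x"] l2_fun_scale[of g "-1"] by simp

lemma l2_fun_trig_span: "g \<in> trig_span L \<Longrightarrow> l2_fun M g"
  using bounded_trig_span measurable_trig_span l2_fun_bounded by metis

lemma l2_dist_triangle:
  assumes "l2_fun M f" "l2_fun M g"
  shows "(LINT x|M. (cmod (f x + g x))\<^sup>2) \<le>
    2 * (LINT x|M. (cmod (f x))\<^sup>2) + 2 * (LINT x|M. (cmod (g x))\<^sup>2)"
proof -
  have "(LINT x|M. (cmod (f x + g x))\<^sup>2) \<le> (LINT x|M. 2 * (cmod (f x))\<^sup>2 + 2 * (cmod (g x))\<^sup>2)"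
    using l2_fun_add[OF assms] assms
    by (intro integral_mono norm_add_power2_le) (auto simp: l2_fun_def)
  then show ?thesis using assms by (simp add: l2_fun_def)
qed

text \<open>Membership in the L^2-closure of the span. Square-integrability is included because the
  integral of a non-integrable function is 0 by convention and would count as small.\<close>

definition approx :: "real set \<Rightarrow> (real \<Rightarrow> complex) \<Rightarrow> bool" where
  "approx L f \<longleftrightarrow> l2_fun M f \<and>
     (\<forall>\<epsilon>>0. \<exists>g\<in>trig_span L. (LINT x|M. (cmod (f x - g x))\<^sup>2) < \<epsilon>)"

lemma approx_trig_span: "g \<in> trig_span L \<Longrightarrow> approx L g"
  unfolding approx_def by (auto intro!: l2_fun_trig_span bexI[of _ g])

lemma approx_closed:
  assumes f: "l2_fun M f" and h: "\<And>\<epsilon>. 0 < \<epsilon> \<Longrightarrow> \<exists>h. approx L h \<and> (LINT x|M. (cmod (f x - h x))\<^sup>2) < \<epsilon>"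
  shows "approx L f"
  unfolding approx_def
proof (intro conjI allI impI f)
  fix \<epsilon> :: real assume e: "0 < \<epsilon>"
  obtain h where h: "approx L h" "(LINT x|M. (cmod (f x - h x))\<^sup>2) < \<epsilon> / 4"
    using h[of "\<epsilon> / 4"] e by auto
  obtain g where g: "g \<in> trig_span L" "(LINT x|M. (cmod (h x - g x))\<^sup>2) < \<epsilon> / 4"
    using h(1) e unfolding approx_def by (meson divide_pos_pos zero_less_numeral)
  have "l2_fun M h" using h by (simp add: approx_def)
  then have "(LINT x|M. (cmod ((f x - h x) + (h x - g x)))\<^sup>2) \<le>
      2 * (LINT x|M. (cmod (f x - h x))\<^sup>2) + 2 * (LINT x|M. (cmod (h x - g x))\<^sup>2)"
    by (intro l2_dist_triangle l2_fun_diff f l2_fun_trig_span[OF g(1)])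
  with h g have "(LINT x|M. (cmod (f x - g x))\<^sup>2) < \<epsilon>" by simp
  then show "\<exists>g\<in>trig_span L. (LINT x|M. (cmod (f x - g x))\<^sup>2) < \<epsilon>" using g by blast
qed

lemma approx_add:
  assumes "approx L f" "approx L g"
  shows "approx L (\<lambda>x. f x + g x)"
  unfolding approx_def
proof (intro conjI allI impI)
  have l2: "l2_fun M f" "l2_fun M g" using assms by (auto simp: approx_def)
  then show "l2_fun M (\<lambda>x. f x + g x)" by (rule l2_fun_add)
  fix \<epsilon> :: real assume e: "0 < \<epsilon>"
  then have e4: "0 < \<epsilon> / 4" by simp
  obtain f' where f': "f' \<in> trig_span L" "(LINT x|M. (cmod (f x - f' x))\<^sup>2) < \<epsilon> / 4"
    using assms(1) e4 unfolding approx_def by meson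
  obtain g' where g': "g' \<in> trig_span L" "(LINT x|M. (cmod (g x - g' x))\<^sup>2) < \<epsilon> / 4"
    using assms(2) e4 unfolding approx_def by meson
  have "(LINT x|M. (cmod ((f x - f' x) + (g x - g' x)))\<^sup>2) \<le>
      2 * (LINT x|M. (cmod (f x - f' x))\<^sup>2) + 2 * (LINT x|M. (cmod (g x - g' x))\<^sup>2)"
    using f'(1) g'(1) by (intro l2_dist_triangle l2_fun_diff l2 l2_fun_trig_span)
  with f' g' have "(LINT x|M. (cmod ((f x - f' x) + (g x - g' x)))\<^sup>2) < \<epsilon>" by simp
  then have "(LINT x|M. (cmod ((f x + g x) - (f' x + g' x)))\<^sup>2) < \<epsilon>"
    by (simp add: algebra_simps)
  then show "\<exists>h\<in>trig_span L. (LINT x|M. (cmod (f x + g x - h x))\<^sup>2) < \<epsilon>"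
    by (intro bexI[of _ "\<lambda>x. f' x + g' x"] trig_span.add f' g')
qed

lemma approx_scale:
  assumes "approx L f"
  shows "approx L (\<lambda>x. c * f x)"
  unfolding approx_def
proof (intro conjI allI impI)
  have l2: "l2_fun M f" using assms by (auto simp: approx_def)
  then show "l2_fun M (\<lambda>x. c * f x)" by (rule l2_fun_scale)
  fix \<epsilon> :: real assume e: "0 < \<epsilon>"
  define C where "C = (cmod c)\<^sup>2 + 1"
  have C: "0 < C" by (simp add: C_def add_nonneg_pos)
  obtain g where g: "g \<in> trig_span L" "(LINT x|M. (cmod (f x - g x))\<^sup>2) < \<epsilon> / C"
    using assms e C unfolding approx_def by (meson divide_pos_pos)
  have "(LINT x|M. (cmod (c * f x - c * g x))\<^sup>2) = (cmod c)\<^sup>2 * (LINT x|M. (cmod (f x - g x))\<^sup>2)"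
    by (simp add: right_diff_distrib[symmetric] norm_mult power_mult_distrib)
  also have "\<dots> \<le> C * (LINT x|M. (cmod (f x - g x))\<^sup>2)"
    by (intro mult_right_mono) (auto simp: C_def)
  also have "\<dots> < \<epsilon>" using g(2) C by (simp add: field_simps)
  finally show "\<exists>h\<in>trig_span L. (LINT x|M. (cmod (c * f x - h x))\<^sup>2) < \<epsilon>"
    by (intro bexI[of _ "\<lambda>x. c * g x"] trig_span.scale g)
qed

lemma approx_zero: "approx L (\<lambda>_. 0)"
  by (rule approx_trig_span[OF trig_span.zero])

lemma approx_sum: "(\<And>i. i \<in> I \<Longrightarrow> approx L (f i)) \<Longrightarrow> approx L (\<lambda>x. \<Sum>i\<in>I. f i x)"
  by (induction I rule: infinite_finite_induct) (auto intro: approx_add approx_zero)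

lemma approx_dominated:
  assumes f: "l2_fun M f" and h: "\<And>n. approx L (h n)" and w: "integrable M w"
    and lim: "\<And>x. (\<lambda>n. h n x) \<longlonglongrightarrow> f x"
    and bound: "\<And>n x. (cmod (f x - h n x))\<^sup>2 \<le> w x"
  shows "approx L f"
proof (rule approx_closed[OF f])
  fix \<epsilon> :: real assume e: "0 < \<epsilon>"
  have [measurable]: "f \<in> borel_measurable M" "h n \<in> borel_measurable M" for n
    using f h[of n] by (auto simp: approx_def l2_fun_def)
  have "(\<lambda>n. LINT x|M. (cmod (f x - h n x))\<^sup>2) \<longlonglongrightarrow> (LINT x|M. 0)"
  proof (rule integral_dominated_convergence[OF _ _ w])
    show "AE x in M. (\<lambda>n. (cmod (f x - h n x))\<^sup>2) \<longlonglongrightarrow> 0"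
    proof (rule AE_I2)
      fix x
      have "(\<lambda>n. (cmod (f x - h n x))\<^sup>2) \<longlonglongrightarrow> (cmod (f x - f x))\<^sup>2"
        by (intro tendsto_intros lim)
      then show "(\<lambda>n. (cmod (f x - h n x))\<^sup>2) \<longlonglongrightarrow> 0" by simp
    qed
  qed (use bound in auto)
  then have "\<forall>\<^sub>F n in sequentially. (LINT x|M. (cmod (f x - h n x))\<^sup>2) < \<epsilon>"
    by (intro order_tendstoD(2)[of _ "LINT x|M. 0"]) (use e in auto)
  then obtain n where "(LINT x|M. (cmod (f x - h n x))\<^sup>2) < \<epsilon>"
    by (auto simp: eventually_sequentially)
  then show "\<exists>h. approx L h \<and> (LINT x|M. (cmod (f x - h x))\<^sup>2) < \<epsilon>" using h by blast
qed

lemma integrable_expo [simp]: "integrable M (expo l)"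
  by (rule integrable_const_bound[where B = 1]) auto

text \<open>Pythagoras for the orthogonal projection of \<open>expo x\<close>, whose coefficient at
  l is the inner product ft (x - l). Of the three sums in the expansion two are subtracted and one
  is added, and each equals the sum of |ft (x - l)|^2.\<close>

lemma l2_dist_expo:
  assumes "finite F" and orth: "\<And>k l. k \<in> F \<Longrightarrow> l \<in> F \<Longrightarrow> k \<noteq> l \<Longrightarrow> ft M (k - l) = 0"
  shows "(LINT y|M. (cmod (expo x y - (\<Sum>l\<in>F. ft M (x - l) * expo l y)))\<^sup>2) =
    1 - (\<Sum>l\<in>F. (cmod (ft M (x - l)))\<^sup>2)"
proof -
  define c where "c l = ft M (x - l)" for l
  have ft0: "ft M 0 = 1" using prob_space by (simp add: ft_def)
  have expo_int: "has_bochner_integral M (expo l) (ft M l)" for l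
    by (simp add: ft_def has_bochner_integral_integrable)
  have cc: "c l * cnj (c l) = of_real ((cmod (c l))\<^sup>2)" for l
    by (rule complex_norm_square[symmetric])
  have sq: "complex_of_real ((cmod (expo x y - (\<Sum>l\<in>F. c l * expo l y)))\<^sup>2) =
      expo 0 y - (\<Sum>l\<in>F. c l * expo (l - x) y) - (\<Sum>l\<in>F. cnj (c l) * expo (x - l) y) +
      (\<Sum>k\<in>F. \<Sum>l\<in>F. (c k * cnj (c l)) * expo (k - l) y)" for y
  proof -
    have "complex_of_real ((cmod (expo x y - (\<Sum>l\<in>F. c l * expo l y)))\<^sup>2) =
        (expo x y - (\<Sum>l\<in>F. c l * expo l y)) * (cnj (expo x y) - (\<Sum>l\<in>F. cnj (c l) * cnj (expo l y)))"
      unfolding complex_norm_square by simp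
    also have "\<dots> = expo x y * cnj (expo x y) - (\<Sum>l\<in>F. c l * (expo l y * cnj (expo x y)))
        - (\<Sum>l\<in>F. cnj (c l) * (expo x y * cnj (expo l y)))
        + (\<Sum>k\<in>F. \<Sum>l\<in>F. (c k * cnj (c l)) * (expo k y * cnj (expo l y)))"
      by (simp add: left_diff_distrib right_diff_distrib sum_distrib_left sum_distrib_right
            sum_product mult_ac) (rule sum.swap)
    finally show ?thesis unfolding expo_mult_cnj by simp
  qed
  have "complex_of_real (LINT y|M. (cmod (expo x y - (\<Sum>l\<in>F. c l * expo l y)))\<^sup>2) =
      (LINT y|M. expo 0 y - (\<Sum>l\<in>F. c l * expo (l - x) y) - (\<Sum>l\<in>F. cnj (c l) * expo (x - l) y) +
      (\<Sum>k\<in>F. \<Sum>l\<in>F. (c k * cnj (c l)) * expo (k - l) y))"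
    by (simp only: integral_complex_of_real[symmetric] sq)
  also have "\<dots> = ft M 0 - (\<Sum>l\<in>F. c l * ft M (l - x)) - (\<Sum>l\<in>F. cnj (c l) * ft M (x - l)) +
      (\<Sum>k\<in>F. \<Sum>l\<in>F. (c k * cnj (c l)) * ft M (k - l))"
    by (intro has_bochner_integral_integral_eq has_bochner_integral_add has_bochner_integral_diff
          has_bochner_integral_sum has_bochner_integral_mult_right expo_int)
  also have "(\<Sum>k\<in>F. \<Sum>l\<in>F. (c k * cnj (c l)) * ft M (k - l)) =
      (\<Sum>k\<in>F. \<Sum>l\<in>F. if k = l then c k * cnj (c l) else 0)"
    by (intro sum.cong refl) (use orth ft0 in auto)
  also have "\<dots> = (\<Sum>l\<in>F. c l * cnj (c l))" using assms(1) by simp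
  also have "(\<Sum>l\<in>F. c l * ft M (l - x)) = (\<Sum>l\<in>F. c l * cnj (c l))"
    by (simp add: c_def cnj_ft)
  also have "(\<Sum>l\<in>F. cnj (c l) * ft M (x - l)) = (\<Sum>l\<in>F. c l * cnj (c l))"
    by (simp add: c_def mult.commute)
  finally have "complex_of_real (LINT y|M. (cmod (expo x y - (\<Sum>l\<in>F. c l * expo l y)))\<^sup>2) =
      of_real (1 - (\<Sum>l\<in>F. (cmod (c l))\<^sup>2))"
    by (simp add: ft0 cc)
  then show ?thesis unfolding of_real_eq_iff c_def .
qed

text \<open>Parseval places every \<open>expo x\<close> in the closed span, hence all trigonometric
  polynomials; as the support is bounded, these approximate continuous functions uniformly almost
  everywhere. Half-lines, Borel sets, simple functions and all of L^2 follow by limits.\<close>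

lemma is_spectrumI:
  assumes supp: "AE x in M. \<bar>x\<bar> \<le> K" and L: "countable L"
    and orth: "\<And>k l. k \<in> L \<Longrightarrow> l \<in> L \<Longrightarrow> k \<noteq> l \<Longrightarrow> ft M (k - l) = 0"
    and parseval: "\<And>x \<epsilon>. 0 < \<epsilon> \<Longrightarrow>
      \<exists>F. finite F \<and> F \<subseteq> L \<and> 1 - \<epsilon> < (\<Sum>l\<in>F. (cmod (ft M (x - l)))\<^sup>2)"
  shows "is_spectrum L M"
proof -
  have expo: "approx L (expo x)" for x
    unfolding approx_def
  proof (intro conjI allI impI)
    show "l2_fun M (expo x)" by (rule l2_fun_bounded[where C = 1]) auto
    fix \<epsilon> :: real assume "0 < \<epsilon>"
    then obtain F where F: "finite F" "F \<subseteq> L" "1 - \<epsilon> < (\<Sum>l\<in>F. (cmod (ft M (x - l)))\<^sup>2)"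
      using parseval by blast
    have "(LINT y|M. (cmod (expo x y - (\<Sum>l\<in>F. ft M (x - l) * expo l y)))\<^sup>2) < \<epsilon>"
      using F by (subst l2_dist_expo) (auto intro!: orth)
    then show "\<exists>g\<in>trig_span L. (LINT y|M. (cmod (expo x y - g y))\<^sup>2) < \<epsilon>"
      by (intro bexI[of _ "\<lambda>y. \<Sum>l\<in>F. ft M (x - l) * expo l y"] trig_span_sum F)
  qed
  have span: "approx L g" if "g \<in> trig_span UNIV" for g
    using that
  proof induction
    case (add f g)
    show ?case by (rule approx_add[OF add.IH])
  next
    case (scale f c)
    show ?case by (rule approx_scale[OF scale.IH])
  qed (rule expo approx_zero)+
  have cont: "approx L (\<lambda>x. of_real (\<phi> x))"
    if \<phi>: "continuous_on UNIV \<phi>" "\<And>x. \<bar>\<phi> x\<bar> \<le> 1" for \<phi>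
  proof (rule approx_closed)
    have \<phi>m [measurable]: "\<phi> \<in> borel_measurable borel"
      by (rule borel_measurable_continuous_onI[OF \<phi>(1)])
    show l2: "l2_fun M (\<lambda>x. of_real (\<phi> x))"
      by (rule l2_fun_bounded[where C = 1]) (use \<phi> in auto)
    fix \<epsilon> :: real assume e: "0 < \<epsilon>"
    define e' where "e' = sqrt (\<epsilon> / 2)"
    have e': "0 < e'" "e'\<^sup>2 = \<epsilon> / 2" using e by (simp_all add: e'_def)
    obtain g where g: "g \<in> trig_span UNIV" "\<And>x. \<bar>x\<bar> \<le> K \<Longrightarrow> cmod (of_real (\<phi> x) - g x) < e'"
      using trig_span_dense_real[OF continuous_on_subset[OF \<phi>(1)] e'(1), of K] by blast
    have "(LINT x|M. (cmod (of_real (\<phi> x) - g x))\<^sup>2) \<le> (LINT x|M. e'\<^sup>2)"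
    proof (rule integral_mono_AE)
      show "AE x in M. (cmod (of_real (\<phi> x) - g x))\<^sup>2 \<le> e'\<^sup>2"
        using supp by eventually_elim (intro power_mono less_imp_le[OF g(2)] norm_ge_zero)
      show "integrable M (\<lambda>x. (cmod (of_real (\<phi> x) - g x))\<^sup>2)"
        using l2_fun_diff[OF l2 l2_fun_trig_span[OF g(1)]] by (simp add: l2_fun_def)
    qed simp
    also have "\<dots> < \<epsilon>" using e e' prob_space by simp
    finally show "\<exists>h. approx L h \<and> (LINT x|M. (cmod (of_real (\<phi> x) - h x))\<^sup>2) < \<epsilon>"
      by (intro exI[of _ g] conjI span g)
  qed
  have bdd: "approx L f" if "\<And>n. approx L (h n)" "f \<in> borel_measurable borel"
    "\<And>x. (\<lambda>n. h n x) \<longlonglongrightarrow> f x" "\<And>x. cmod (f x) \<le> 1" "\<And>n x. cmod (h n x) \<le> 1" for f h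
  proof (rule approx_dominated[OF l2_fun_bounded[OF that(2,4)] that(1) _ that(3)])
    show "(cmod (f x - h n x))\<^sup>2 \<le> 2\<^sup>2" for n x
      using norm_triangle_ineq4[of "f x" "h n x"] that(4)[of x] that(5)[of n x]
      by (intro power_mono) auto
  qed simp
  have atMost: "approx L (indicator {..a})" for a :: real
  proof -
    \<comment> \<open>For n > 0 a ramp that falls from 1 at a to 0 at a + 1 / n: continuous, and
      convergent to the indicator of the half-line.\<close>
    define r where "r n x = max 0 (min 1 (1 - real n * (x - a)))" for n x
    show ?thesis
    proof (rule bdd[of "\<lambda>n x. complex_of_real (r n x)"])
      show "approx L (\<lambda>x. of_real (r n x))" for n
        unfolding r_def by (rule cont) (auto intro!: continuous_intros)
      show "cmod (of_real (r n x)) \<le> 1" for n x by (simp add: r_def)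
      show "(\<lambda>n. complex_of_real (r n x)) \<longlonglongrightarrow> indicator {..a} x" for x
      proof (cases "x \<le> a")
        case True
        then have "r n x = 1" for n
          by (simp add: r_def mult_le_0_iff)
        then show ?thesis using True by simp
      next
        case False
        then obtain N where N: "1 < real N * (x - a)"
          using reals_Archimedean3[of "x - a"] by auto
        have "complex_of_real (r n x) = 0" if "N \<le> n" for n
        proof -
          have "real N * (x - a) \<le> real n * (x - a)" using that False by (intro mult_right_mono) auto
          then show ?thesis using N by (simp add: r_def)
        qed
        then have "\<forall>\<^sub>F n in sequentially. complex_of_real (r n x) = 0"
          by (auto simp: eventually_sequentially)
        then show ?thesis using False by (simp add: tendsto_eventually)
      qed
    qed (auto simp: indicator_def)
  qed
  have ind: "approx L (indicator A)" if "A \<in> sets borel" for A :: "real set"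
  proof -
    have mem: "A \<in> sigma_sets UNIV (range (\<lambda>a::real. {..a}))"
      using that unfolding borel_eq_atMost by simp
    have int: "Int_stable (range (\<lambda>a::real. {..a}))"
      by (auto simp: Int_stable_def)
    have pow: "range (\<lambda>a::real. {..a}) \<subseteq> Pow UNIV" by simp
    \<comment> \<open>Dynkin's lemma: half-lines are closed under intersection and generate the
      Borel sets. Complements use that \<open>expo 0\<close> is the constant 1.\<close>
    from mem show ?thesis
    proof (induction rule: sigma_sets_induct_disjoint[OF int pow, consumes 1, case_names basic empty compl union])
      case (basic A)
      then show ?case using atMost by auto
    next
      case empty
      show ?case using approx_zero by (simp add: indicator_def[abs_def])
    next
      case (compl A)
      have "approx L (\<lambda>x. expo 0 x + - 1 * indicator A x)"
        by (intro approx_add approx_scale expo compl)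
      then show ?case
        by (rule arg_cong[where f = "approx L", THEN iffD1, rotated]) (auto simp: indicator_def)
    next
      case (union A)
      have A: "A i \<in> sets borel" for i
        using union(2) unfolding borel_eq_atMost by auto
      have ind_sum: "(\<Sum>i<n. indicator (A i) x) = (indicator (\<Union>i<n. A i) x :: complex)" for n x
        using union(1) by (intro indicator_UN_disjoint[symmetric]) (auto simp: disjoint_family_on_def)
      show ?case
      proof (rule bdd[of "\<lambda>n x. \<Sum>i<n. indicator (A i) x"])
        show "approx L (\<lambda>x. \<Sum>i<n. indicator (A i) x)" for n
          by (intro approx_sum union)
        show "(\<lambda>n. \<Sum>i<n. indicator (A i) x) \<longlonglongrightarrow> (indicator (\<Union>i. A i) x :: complex)" for x
          unfolding ind_sum by (rule LIMSEQ_indicator_UN)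
        show "cmod (\<Sum>i<n. indicator (A i) x) \<le> 1" for n x
          unfolding ind_sum by (simp add: indicator_def)
      qed (use A in \<open>auto simp: indicator_def\<close>)
    qed
  qed
  have all: "approx L f" if f: "l2_fun M f" for f
  proof -
    have [measurable]: "f \<in> borel_measurable M" using f by (simp add: l2_fun_def)
    obtain s where s: "\<And>i. simple_function M (s i)" "\<And>x. (\<lambda>i. s i x) \<longlonglongrightarrow> f x"
        "\<And>i x. cmod (s i x) \<le> 2 * cmod (f x)"
      using borel_measurable_implies_sequence_metric[of f M 0] by (auto simp: dist_norm)
    show ?thesis
    proof (rule approx_dominated[OF f _ _ s(2)])
      fix i
      have fin: "finite (range (s i))" using s(1)[of i] by (simp add: simple_function_def)
      have "s i -` {y} \<in> sets borel" for y
        using simple_functionD(2)[OF s(1)[of i], of "{y}"] by simp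
      then have "approx L (\<lambda>x. \<Sum>y\<in>range (s i). y * indicator (s i -` {y}) x)"
        by (intro approx_sum approx_scale ind)
      moreover have "(\<Sum>y\<in>range (s i). y * indicator (s i -` {y}) x) = s i x" for x
        using fin by (simp add: indicator_def sum.delta' if_distrib cong: if_cong)
      ultimately show "approx L (s i)" by simp
      show "(cmod (f x - s i x))\<^sup>2 \<le> 9 * (cmod (f x))\<^sup>2" for x
      proof -
        have "cmod (f x - s i x) \<le> 3 * cmod (f x)"
          using norm_triangle_ineq4[of "f x" "s i x"] s(3)[of i x] by linarith
        then have "(cmod (f x - s i x))\<^sup>2 \<le> (3 * cmod (f x))\<^sup>2" by (intro power_mono) auto
        then show ?thesis by (simp add: power_mult_distrib)
      qed
      show "integrable M (\<lambda>x. 9 * (cmod (f x))\<^sup>2)" using f by (simp add: l2_fun_def)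
    qed
  qed
  show ?thesis
    unfolding is_spectrum_def
  proof (intro conjI ballI allI impI)
    show "(LINT x|M. expo l x * cnj (expo l' x)) = 0" if "l \<in> L" "l' \<in> L" "l \<noteq> l'" for l l'
      unfolding expo_mult_cnj using orth[OF that] by (simp add: ft_def)
    fix f and \<epsilon> :: real assume "l2_fun M f" "0 < \<epsilon>"
    then obtain g where g: "g \<in> trig_span L" "(LINT x|M. (cmod (f x - g x))\<^sup>2) < \<epsilon>"
      using all unfolding approx_def by blast
    from g(1) obtain F c where "finite F" "F \<subseteq> L" "g = (\<lambda>x. \<Sum>l\<in>F. c l * expo l x)"
      by (rule trig_spanE)
    then show "\<exists>F c. finite F \<and> F \<subseteq> L \<and>
        (LINT x|M. (cmod (f x - (\<Sum>l\<in>F. c l * expo l x)))\<^sup>2) < \<epsilon>"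
      using g(2) by blast
  qed (rule L)
qed

end

text \<open>If |x / b + i / q| > R, then |x| > b (R - 1) \<ge> 4 (R - 1) \<ge> 2 R as soon as R
  \<ge> 2. By self-similarity the tail beyond R is no heavier than the tail beyond 2 R, and
  iteration sends the latter to 0.\<close>

lemma (in cantor) AE_abs_le_2: "AE x in M. \<bar>x\<bar> \<le> 2"
proof -
  interpret real_distribution M by (rule real_distribution_M)
  define T where "T R = {x::real. R < \<bar>x\<bar>}" for R
  have T [measurable]: "T R \<in> sets borel" for R unfolding T_def by measurable
  have step: "measure M (T R) \<le> measure M (T (2 * R))" if R: "2 \<le> R" for R
  proof -
    have "cantor_map q b i -` T R \<subseteq> T (2 * R)" if i: "i < q" for i
    proof
      fix x assume "x \<in> cantor_map q b i -` T R"
      then have "R < \<bar>x / real b + real i / real q\<bar>" by (simp add: T_def cantor_map_def)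
      moreover have "real i / real q \<le> 1" using i by simp
      ultimately have "R - 1 < \<bar>x\<bar> / real b"
        using abs_triangle_ineq[of "x / real b" "real i / real q"] by simp
      then have "(R - 1) * real b < \<bar>x\<bar>" using b_ge_4 by (simp add: field_simps)
      moreover have "(R - 1) * 4 \<le> (R - 1) * real b" using R b_ge_4 by (intro mult_left_mono) auto
      ultimately show "x \<in> T (2 * R)" using R by (simp add: T_def)
    qed
    then have "measure M (cantor_map q b i -` T R) \<le> measure M (T (2 * R))" if "i < q" for i
      using that by (intro finite_measure_mono) auto
    then have "(\<Sum>i<q. measure M (cantor_map q b i -` T R)) \<le> (\<Sum>i<q. measure M (T (2 * R)))"
      by (intro sum_mono) auto
    moreover have "measure M (T R) = (1 / real q) * (\<Sum>i<q. measure M (cantor_map q b i -` T R))"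
      using M T unfolding is_cantor_measure_def by blast
    ultimately have "real q * measure M (T R) \<le> real q * measure M (T (2 * R))" using q by simp
    then show ?thesis using q by simp
  qed
  have iter: "measure M (T 2) \<le> measure M (T (2 * 2 ^ n))" for n
  proof (induction n)
    case (Suc n)
    have "(2::real) * 1 \<le> 2 * 2 ^ n" by (intro mult_left_mono) auto
    then show ?case using Suc step[of "2 * 2 ^ n"] by (simp add: mult_ac)
  qed simp
  have "(\<lambda>n. measure M (T (2 * 2 ^ n))) \<longlonglongrightarrow> measure M (\<Inter>n. T (2 * 2 ^ n))"
  proof (rule finite_Lim_measure_decseq)
    show "decseq (\<lambda>n. T (2 * 2 ^ n))"
    proof (rule decseq_SucI)
      fix n
      have "(2::real) * 2 ^ n \<le> 2 * 2 ^ Suc n" by simp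
      then show "T (2 * 2 ^ Suc n) \<subseteq> T (2 * 2 ^ n)" unfolding T_def by force
    qed
  qed auto
  moreover have "(\<Inter>n. T (2 * 2 ^ n)) = {}"
  proof -
    have "\<exists>n. x \<notin> T (2 * 2 ^ n)" for x
    proof -
      obtain n where "\<bar>x\<bar> < 2 ^ n" using real_arch_pow[of 2 "\<bar>x\<bar>"] by auto
      then have "x \<notin> T (2 * 2 ^ n)" by (simp add: T_def)
      then show ?thesis by blast
    qed
    then show ?thesis by blast
  qed
  ultimately have "measure M (T 2) \<le> 0"
    using LIMSEQ_le_const[of "\<lambda>n. measure M (T (2 * 2 ^ n))" 0 "measure M (T 2)"] iter by auto
  then have "measure M (T 2) = 0" by (simp add: measure_le_0_iff)
  then have "T 2 \<in> null_sets M"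
    by (intro null_setsI) (auto simp: emeasure_eq_measure)
  moreover have "{x \<in> space M. \<not> \<bar>x\<bar> \<le> 2} \<subseteq> T 2" by (auto simp: T_def)
  ultimately show ?thesis by (rule AE_I')
qed

theorem theorem2p4:
  fixes q b :: nat and \<tau> :: "nat list \<Rightarrow> int"
  assumes "2 \<le> q" and "q dvd b" and "2 \<le> b div q"
    and "maximal_tree_mapping q b \<tau>"
    and "level_diff_sup q \<tau> < \<infinity>"
  shows "is_spectrum (tree_spectrum q b \<tau>) (cantor_measure q b)"
proof -
  have "2 * 1 \<le> (b div q) * q" using assms(1,3) by (intro mult_mono) auto
  then have b: "2 \<le> b" using assms(2) by simp
  interpret cantor_tree q b "cantor_measure q b" \<tau>
  proof
    show "is_cantor_measure q b (cantor_measure q b)"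
      by (rule is_cantor_measure_cantor_measure) (use assms(1) b in auto)
    show "tree_mapping q b \<tau>" using assms(4) by (simp add: maximal_tree_mapping_def)
  qed (rule assms)+
  interpret real_distribution "cantor_measure q b" by (rule real_distribution_M)
  show ?thesis
  proof (rule is_spectrumI[OF AE_abs_le_2])
    have "tree_spectrum q b \<tau> \<subseteq>
        range (\<lambda>w. \<Sum>n. real_of_int (\<tau> (pref w (Suc n))) * real b ^ n)"
      by (auto simp: tree_spectrum_def)
    then show "countable (tree_spectrum q b \<tau>)"
      by (rule countable_subset) simp
    show "\<exists>F. finite F \<and> F \<subseteq> tree_spectrum q b \<tau> \<and>
        1 - \<epsilon> < (\<Sum>l\<in>F. (cmod (ft (cantor_measure q b) (x - l)))\<^sup>2)" if "0 < \<epsilon>" for x \<epsilon>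
      using parseval[OF assms(5) that, of x] by metis
  qed (rule tree_spectrum_orthogonal)
qed

end
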